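(* Let $(p_N)_{N\in\mathbb N}$ be a sequence of edge probabilities in $[0,1]$ such that $$\frac{Np_N}{\log N}\longrightarrow\infty\qquad\text{and}\qquad\limsup_{N\to\infty}p_N<1;$$ equivalently to the second condition, suppose there is a constant $\delta_0>0$ such that $p_N\leq1-\delta_0$ for all sufficiently large $N$. Then there is a constant $c=c(\delta_0)>0$, depending only on $\delta_0$, such that $$cN\leq\operatorname{FR}_{\min}(G(N,p_N))\leq N$$ with probability $1-o(1)$ as $N\to\infty$.
   Context: $G(N,p)$ is the Erdős–Rényi random graph on the labeled vertex set $[N]=\{1,\dots,N\}$, in which each of the $\binom N2$ possible edges is present independently with probability $p$. A vertex labeling of a graph $G=(V,E)$ of order $N=|V|$ is a bijection $\sigma:V\to\mathbb Z_N=\mathbb Z/N\mathbb Z$. The adjacency matrix under $\sigma$ is the $N\times N$ matrix $A_\sigma$, indexed by $\mathbb Z_N\times\mathbb Z_N$, with $(A_\sigma)_{x,y}=1$ if the vertices labeled $x$ and $y$ are adjacent and $0$ otherwise. $F$ is the unitary Fourier matrix $F_{mx}=\frac1{\sqrt N}e^{-2\pi i mx/N}$. The Fourier ratio of a nonzero $N\times N$ matrix $M$ is $\operatorname{FR}(M)=\|FMF\|_1/\|FMF\|_2$, where $\|\cdot\|_1$ is the entrywise $\ell^1$-norm and $\|\cdot\|_2$ the Frobenius norm. The edge complexity of a graph with at least one edge is $\operatorname{FR}_{\min}(G)=\min_\sigma\operatorname{FR}(A_\sigma)$, the minimum over all vertex labelings. It is defined only for graphs with at least one edge; the event in the claim is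 understood to include that $G(N,p_N)$ has at least one edge. *)

theory Defs
  imports
    "HOL-Probability.Probability"
    "HOL-Probability.Product_PMF"
    "Jordan_Normal_Form.Matrix"
begin

text \<open>A graph is a pair of a vertex set and a set of edges, an edge being a two-element
  set of vertices.\<close>

type_synonym 'a graph = "'a set \<times> 'a set set"

definition simple_graph :: "'a graph \<Rightarrow> bool" where
  "simple_graph G \<longleftrightarrow> finite (fst G) \<and> (\<forall>e\<in>snd G. e \<subseteq> fst G \<and> card e = 2)"

definition possible_edges :: "nat \<Rightarrow> nat set set" where
  "possible_edges N = {e. e \<subseteq> {1..N} \<and> card e = 2}"

text \<open>The distribution of \<open>G(N, p)\<close>: one independent Bernoulli variable for each possible edge.
  The library function \<open>bernoulli_pmf\<close> is meaningful for \<open>p\<close> in \<open>[0, 1]\<close>.\<close>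

definition erdos_renyi :: "nat \<Rightarrow> real \<Rightarrow> nat graph pmf" where
  "erdos_renyi N p =
     map_pmf (\<lambda>f. ({1..N}, {e \<in> possible_edges N. f e}))
       (Pi_pmf (possible_edges N) False (\<lambda>_. bernoulli_pmf p))"

text \<open>The residue ring \<open>\<int>/N\<int>\<close> is represented by the residues \<open>{..<N}\<close>. Nothing below uses its
  arithmetic, except that the Fourier kernel depends on \<open>m\<close> and \<open>x\<close> only modulo \<open>N\<close>.\<close>

definition vertex_labeling :: "'a graph \<Rightarrow> ('a \<Rightarrow> nat) \<Rightarrow> bool" where
  "vertex_labeling G \<sigma> \<longleftrightarrow> bij_betw \<sigma> (fst G) {..<card (fst G)}"

definition adjacency_matrix :: "'a graph \<Rightarrow> ('a \<Rightarrow> nat) \<Rightarrow> complex mat" where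
  "adjacency_matrix G \<sigma> = Matrix.mat (card (fst G)) (card (fst G))
     (\<lambda>(x, y). if \<exists>u\<in>fst G. \<exists>v\<in>fst G. \<sigma> u = x \<and> \<sigma> v = y \<and> {u, v} \<in> snd G then 1 else 0)"

definition fourier_matrix :: "nat \<Rightarrow> complex mat" where
  "fourier_matrix N = Matrix.mat N N
     (\<lambda>(m, x). complex_of_real (1 / sqrt (real N)) *
        exp (- (2 * complex_of_real pi * \<i> * of_nat m * of_nat x / of_nat N)))"

definition entrywise_l1_norm :: "complex mat \<Rightarrow> real" where
  "entrywise_l1_norm M = (\<Sum>i<dim_row M. \<Sum>j<dim_col M. cmod (M $$ (i, j)))"

definition frobenius_norm :: "complex mat \<Rightarrow> real" where
  "frobenius_norm M = sqrt (\<Sum>i<dim_row M. \<Sum>j<dim_col M. (cmod (M $$ (i, j)))\<^sup>2)"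

text \<open>Intended for nonzero square matrices; the zero matrix gets the junk value \<open>0 / 0 = 0\<close>.\<close>

definition fourier_ratio :: "complex mat \<Rightarrow> real" where
  "fourier_ratio M =
     (let F = fourier_matrix (dim_row M); T = F * M * F
      in entrywise_l1_norm T / frobenius_norm T)"

definition labeling_fourier_ratios :: "'a graph \<Rightarrow> real set" where
  "labeling_fourier_ratios G =
     {fourier_ratio (adjacency_matrix G \<sigma>) | \<sigma>. vertex_labeling G \<sigma>}"

text \<open>Intended for finite graphs with at least one edge.\<close>

definition edge_complexity :: "'a graph \<Rightarrow> real" where
  "edge_complexity G = Min (labeling_fourier_ratios G)"

text \<open>The minimum in the definition of \<open>edge_complexity\<close> is over a finite nonempty set.\<close>

lemma finite_labeling_fourier_ratios:
  assumes "finite (fst G)"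
  shows "finite (labeling_fourier_ratios G)"
proof -
  let ?V = "fst G"
  let ?f = "\<lambda>\<sigma>. fourier_ratio (adjacency_matrix G \<sigma>)"
  have "labeling_fourier_ratios G \<subseteq> ?f ` (?V \<rightarrow>\<^sub>E {..<card ?V})"
  proof
    fix r assume "r \<in> labeling_fourier_ratios G"
    then obtain \<sigma> where r: "r = ?f \<sigma>" and \<sigma>: "vertex_labeling G \<sigma>"
      by (auto simp: labeling_fourier_ratios_def)
    have "(\<exists>u\<in>?V. \<exists>v\<in>?V. restrict \<sigma> ?V u = x \<and> restrict \<sigma> ?V v = y \<and> {u, v} \<in> snd G) \<longleftrightarrow>
          (\<exists>u\<in>?V. \<exists>v\<in>?V. \<sigma> u = x \<and> \<sigma> v = y \<and> {u, v} \<in> snd G)" for x y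
      by auto
    then have "adjacency_matrix G (restrict \<sigma> ?V) = adjacency_matrix G \<sigma>"
      by (simp only: adjacency_matrix_def)
    moreover have "restrict \<sigma> ?V \<in> ?V \<rightarrow>\<^sub>E {..<card ?V}"
      using \<sigma> by (auto simp: vertex_labeling_def bij_betw_def)
    ultimately show "r \<in> ?f ` (?V \<rightarrow>\<^sub>E {..<card ?V})"
      using r by (metis (no_types, lifting) image_eqI)
  qed
  moreover have "finite (?V \<rightarrow>\<^sub>E {..<card ?V})"
    using assms by (intro finite_PiE) auto
  ultimately show ?thesis
    by (meson finite_imageI finite_subset)
qed

lemma labeling_fourier_ratios_nonempty:
  assumes "finite (fst G)"
  shows "labeling_fourier_ratios G \<noteq> {}"
proof -
  obtain \<sigma> where "bij_betw \<sigma> (fst G) {0..<card (fst G)}"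
    using ex_bij_betw_finite_nat[OF assms] by blast
  then show ?thesis
    by (auto simp: labeling_fourier_ratios_def vertex_labeling_def atLeast0LessThan)
qed

lemma erdos_renyi_simple_graph:
  assumes "G \<in> set_pmf (erdos_renyi N p)"
  shows "simple_graph G \<and> fst G = {1..N}"
  using assms unfolding erdos_renyi_def simple_graph_def possible_edges_def set_map_pmf
  by (elim imageE) simp

end

theory Submission
  imports Defs "HOL-Probability.Hoeffding" "HOL-Real_Asymp.Real_Asymp"
begin

text \<open>Fix a labeling. The entrywise norm \<open>\<parallel>FAF\<parallel>\<^sub>1\<close> is a convex function of the independent edge
  indicators, and by Parseval and Cauchy--Schwarz it is \<open>N\<surd>2\<close>-Lipschitz for the Euclidean distance.
  Every entry of \<open>FAF\<close> has first absolute moment of order \<open>\<surd>p\<close>, by decay of its characteristic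
  function, so the mean of \<open>\<parallel>FAF\<parallel>\<^sub>1\<close> is at least of order \<open>N\<^sup>2\<surd>p\<close>. Dimension-free concentration of
  convex functions of independent bounded variables then makes \<open>\<parallel>FAF\<parallel>\<^sub>1\<close> smaller than half of this
  with probability at most \<open>exp (- c N\<^sup>2 p)\<close>. Since \<open>N p\<close> dominates \<open>ln N\<close>, this survives a union bound
  over all \<open>N!\<close> labelings. The Frobenius norm is of order \<open>N\<surd>p\<close> because its square is twice the number
  of edges.\<close>

section \<open>Products of Bernoulli distributions\<close>

abbreviation bernoulli_product :: "'a set \<Rightarrow> real \<Rightarrow> ('a \<Rightarrow> bool) pmf" where
  "bernoulli_product E p \<equiv> Pi_pmf E False (\<lambda>_. bernoulli_pmf p)"

lemma finite_set_bernoulli_product [simp]: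
  assumes "finite E"
  shows "finite (set_pmf (bernoulli_product E p))"
  using assms by (intro finite_subset[OF set_Pi_pmf_subset']) auto

lemma integrable_bernoulli_product [simp]:
  fixes f :: "('a \<Rightarrow> bool) \<Rightarrow> 'b :: {banach, second_countable_topology}"
  assumes "finite E"
  shows "integrable (measure_pmf (bernoulli_product E p)) f"
  using assms by (intro integrable_measure_pmf_finite) simp

lemma expectation_mono_bernoulli_product:
  fixes f g :: "('a \<Rightarrow> bool) \<Rightarrow> real"
  assumes "finite E" "\<And>\<omega>. f \<omega> \<le> g \<omega>"
  shows "measure_pmf.expectation (bernoulli_product E p) f
         \<le> measure_pmf.expectation (bernoulli_product E p) g"
  using assms by (intro integral_mono) auto

text \<open>Conditioning on the coordinate \<open>e\<close>. Inductions over the edge set run on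
  this decomposition.\<close>

lemma expectation_bernoulli_product_insert:
  fixes f :: "('a \<Rightarrow> bool) \<Rightarrow> 'b :: {banach, second_countable_topology}"
  assumes "finite E" "e \<notin> E" "0 \<le> p" "p \<le> 1"
  shows "measure_pmf.expectation (bernoulli_product (insert e E) p) f =
         p *\<^sub>R measure_pmf.expectation (bernoulli_product E p) (\<lambda>\<omega>. f (fun_upd \<omega> e True)) +
         (1 - p) *\<^sub>R measure_pmf.expectation (bernoulli_product E p) (\<lambda>\<omega>. f (fun_upd \<omega> e False))"
proof -
  have eq: "bernoulli_product (insert e E) p =
      bernoulli_pmf p \<bind> (\<lambda>b. map_pmf (\<lambda>\<omega>. fun_upd \<omega> e b) (bernoulli_product E p))"
    using assms by (simp add: Pi_pmf_insert' map_pmf_def)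
  have "measure_pmf.expectation (bernoulli_product (insert e E) p) f =
      (\<Sum>b\<in>UNIV. pmf (bernoulli_pmf p) b *\<^sub>R
        measure_pmf.expectation (map_pmf (\<lambda>\<omega>. fun_upd \<omega> e b) (bernoulli_product E p)) f)"
    unfolding eq using assms by (intro pmf_expectation_bind) auto
  then show ?thesis
    using assms by (simp add: UNIV_bool add.commute)
qed

text \<open>Independence of the coordinates. The codomain is a general normed field because the
  complex case yields characteristic functions and the real case a moment generating
  function.\<close>

lemma expectation_prod_bernoulli_product:
  fixes f :: "'a \<Rightarrow> bool \<Rightarrow> 'b :: {banach, second_countable_topology, real_normed_field}"
  assumes "finite E" "0 \<le> p" "p \<le> 1"
  shows "measure_pmf.expectation (bernoulli_product E p) (\<lambda>\<omega>. \<Prod>e\<in>E. f e (\<omega> e)) =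
         (\<Prod>e\<in>E. p *\<^sub>R f e True + (1 - p) *\<^sub>R f e False)"
  using assms(1)
proof (induction E rule: finite_induct)
  case (insert e E)
  have "(\<Prod>x\<in>E. f x ((fun_upd \<omega> e b) x)) = (\<Prod>x\<in>E. f x (\<omega> x))" for \<omega> b
    using insert.hyps by (intro prod.cong) auto
  then show ?case
    using insert assms by (simp add: expectation_bernoulli_product_insert algebra_simps)
qed simp

section \<open>The two-point inequality and convexity of logarithmic moments\<close>

text \<open>For nonnegative \<open>x\<close> this is Hoeffding's estimate for a symmetric two-point
  variable, multiplied out; both sides are even in \<open>x\<close>.\<close>

lemma exp_plus_exp_minus_le:
  fixes x :: real
  shows "exp x + exp (- x) \<le> 2 * exp (x\<^sup>2 / 2)"
proof -
  have *: "exp x + exp (- x) \<le> 2 * exp (x\<^sup>2 / 2)" if "x \<ge> 0" for x :: real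
  proof -
    have "- x + ln ((1 + exp (2 * x)) / 2) \<le> x\<^sup>2 / 2"
      using Hoeffdings_lemma_aux[of "2 * x" "1 / 2"] that by (simp add: field_simps power2_eq_square)
    then have "exp (ln ((1 + exp (2 * x)) / 2)) \<le> exp (x\<^sup>2 / 2 + x)"
      by simp
    then have "(1 + exp (2 * x)) / 2 \<le> exp (x\<^sup>2 / 2) * exp x"
      by (subst (asm) exp_ln) (auto simp: exp_add add_pos_pos)
    then have "(1 + exp (2 * x)) * exp (- x) \<le> 2 * exp (x\<^sup>2 / 2) * exp x * exp (- x)"
      by (intro mult_right_mono) auto
    moreover have "(1 + exp (2 * x)) * exp (- x) = exp x + exp (- x)"
      by (simp add: distrib_right flip: exp_add)
    moreover have "exp x * exp (- x) = 1" by (simp flip: exp_add)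
    ultimately show ?thesis by (simp add: mult.assoc)
  qed
  show ?thesis
    using *[of x] *[of "- x"] by (cases "x \<ge> 0") auto
qed

text \<open>The one-coordinate case of property (\<tau>): \<open>h0\<close> and \<open>h1\<close>
  dominate the suprema of \<open>k\<close> minus a quadratic cost centred at 0 and at 1. After
  expansion the diagonal terms are at most p^2 and (1 - p)^2, so it suffices that the two mixed
  exponentials add up to at most 2. Convexity provides the required gain in \<open>h1\<close>, and
  in \<open>h0\<close> when \<open>d\<close> is large.\<close>

lemma two_point_ordered:
  fixes k :: "real \<Rightarrow> real"
  assumes p: "0 \<le> p" "p \<le> 1"
    and cvx: "\<And>x y t. 0 \<le> t \<Longrightarrow> t \<le> 1 \<Longrightarrow> k ((1 - t) * x + t * y) \<le> (1 - t) * k x + t * k y"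
    and h0: "\<And>s. k s \<le> h0 + s\<^sup>2 / 8" and h1: "\<And>s. k s \<le> h1 + (s - 1)\<^sup>2 / 8"
    and le: "k 0 \<le> k 1"
  shows "(p * exp (k 1) + (1 - p) * exp (k 0)) * (p * exp (- h1) + (1 - p) * exp (- h0)) \<le> 1"
proof -
  define d where "d = k 1 - k 0"
  have d: "0 \<le> d" using le by (simp add: d_def)
  \<comment> \<open>The point 1 lies on the segment from 0 to \<open>s\<close>, so beyond 1 a convex
    function stays above the line through its values at 0 and 1.\<close>
  have ext: "k s \<ge> k 1 + d * (s - 1)" if "s \<ge> 1" for s
  proof -
    have "k ((1 - 1 / s) * 0 + (1 / s) * s) \<le> (1 - 1 / s) * k 0 + (1 / s) * k s"
      using that by (intro cvx) auto
    then have "s * k 1 \<le> s * ((1 - 1 / s) * k 0 + (1 / s) * k s)"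
      using that by (intro mult_left_mono) auto
    also have "\<dots> = (s - 1) * k 0 + k s"
      using that by (simp add: field_simps)
    finally show ?thesis by (simp add: d_def algebra_simps)
  qed
  \<comment> \<open>The point 1 + 4d maximises d (s - 1) - (s - 1)^2 / 8, and the maximum is 2
    d^2.\<close>
  have h1': "h1 \<ge> k 1 + 2 * d\<^sup>2"
    using ext[of "1 + 4 * d"] h1[of "1 + 4 * d"] d by (simp add: power2_eq_square)
  have h0': "h0 \<ge> k 0" using h0[of 0] by simp
  have cross: "exp (k 0 - h1) + exp (k 1 - h0) \<le> 2"
  \<comment> \<open>The analogous maximiser for \<open>h0\<close> is s = 4d. It lies in the range of
    \<open>ext\<close> exactly when d \<ge> 1/4; for smaller \<open>d\<close> only the trivial bound
    at s = 0 is used.\<close>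
  proof (cases "d \<ge> 1 / 4")
    case True
    have "h0 \<ge> k 0 + 2 * d\<^sup>2"
    proof -
      have "k 1 + d * (4 * d - 1) \<le> h0 + (4 * d)\<^sup>2 / 8"
        using ext[of "4 * d"] h0[of "4 * d"] True by linarith
      moreover have "d * (4 * d - 1) = 4 * d\<^sup>2 - d" "(4 * d)\<^sup>2 / 8 = 2 * d\<^sup>2"
        by (auto simp: power2_eq_square algebra_simps)
      ultimately show ?thesis unfolding d_def by linarith
    qed
    then have "exp (k 0 - h1) + exp (k 1 - h0) \<le> exp (- d - 2 * d\<^sup>2) + exp (d - 2 * d\<^sup>2)"
      using h1' by (intro add_mono) (auto simp: d_def)
    also have "\<dots> = (exp d + exp (- d)) * exp (- 2 * d\<^sup>2)"
      by (simp add: distrib_right flip: exp_add)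
    also have "\<dots> \<le> 2 * exp (d\<^sup>2 / 2) * exp (- 2 * d\<^sup>2)"
      by (intro mult_right_mono exp_plus_exp_minus_le) auto
    also have "\<dots> = 2 * exp (- (3 / 2) * d\<^sup>2)"
      by (simp add: flip: exp_add)
    also have "\<dots> \<le> 2" by simp
    finally show ?thesis .
  next
    case False
    \<comment> \<open>The exponents -d - 2 d^2 and d are -w and w, both shifted by -d^2. Since d <
      1/4, w is at most 5d/4, so w^2 / 2 does not exceed d^2.\<close>
    define w where "w = d + d\<^sup>2"
    have "w \<le> (5 / 4) * d"
      using False d mult_left_mono[of d "1 / 4" d] by (simp add: w_def power2_eq_square)
    then have "w\<^sup>2 \<le> ((5 / 4) * d)\<^sup>2"
      using d by (intro power_mono) (auto simp: w_def)
    moreover have "((5 / 4) * d)\<^sup>2 = 25 / 16 * d\<^sup>2"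
      by (simp add: power2_eq_square)
    ultimately have w2: "w\<^sup>2 / 2 - d\<^sup>2 \<le> 0"
      using zero_le_power2[of d] by linarith
    have "exp (k 0 - h1) + exp (k 1 - h0) \<le> exp (- d - 2 * d\<^sup>2) + exp d"
      using h1' h0' by (intro add_mono) (auto simp: d_def)
    also have "\<dots> = (exp w + exp (- w)) * exp (- d\<^sup>2)"
      by (simp add: w_def distrib_right flip: exp_add)
    also have "\<dots> \<le> 2 * exp (w\<^sup>2 / 2) * exp (- d\<^sup>2)"
      by (intro mult_right_mono exp_plus_exp_minus_le) auto
    also have "\<dots> = 2 * exp (w\<^sup>2 / 2 - d\<^sup>2)"
      by (simp add: flip: exp_add)
    also have "\<dots> \<le> 2" using w2 by simp
    finally show ?thesis .
  qed
  have split: "exp (a - b) = exp a * exp (- b)" for a b :: real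
    by (simp flip: exp_add)
  have "(p * exp (k 1) + (1 - p) * exp (k 0)) * (p * exp (- h1) + (1 - p) * exp (- h0)) =
      p\<^sup>2 * exp (k 1 - h1) + (1 - p)\<^sup>2 * exp (k 0 - h0)
      + p * (1 - p) * (exp (k 0 - h1) + exp (k 1 - h0))"
    unfolding split power2_eq_square by (simp only: algebra_simps)
  also have "\<dots> \<le> p\<^sup>2 * 1 + (1 - p)\<^sup>2 * 1 + p * (1 - p) * 2"
    using p h1' h0' cross
    by (intro add_mono mult_left_mono)
      (auto intro: order_trans[OF _ h1'] simp: add_increasing2)
  also have "\<dots> = 1" by (simp add: power2_eq_square algebra_simps)
  finally show ?thesis .
qed

text \<open>If \<open>k\<close> decreases from 0 to 1, the reflection of \<open>s\<close> to
  \<open>1 - s\<close> exchanges \<open>h0\<close> with \<open>h1\<close> and \<open>p\<close> with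
  \<open>1 - p\<close>, which reduces to the ordered case.\<close>

lemma two_point:
  fixes k :: "real \<Rightarrow> real"
  assumes p: "0 \<le> p" "p \<le> 1"
    and cvx: "\<And>x y t. 0 \<le> t \<Longrightarrow> t \<le> 1 \<Longrightarrow> k ((1 - t) * x + t * y) \<le> (1 - t) * k x + t * k y"
    and h0: "\<And>s. k s \<le> h0 + s\<^sup>2 / 8" and h1: "\<And>s. k s \<le> h1 + (s - 1)\<^sup>2 / 8"
  shows "(p * exp (k 1) + (1 - p) * exp (k 0)) * (p * exp (- h1) + (1 - p) * exp (- h0)) \<le> 1"
proof (cases "k 0 \<le> k 1")
  case False
  have "((1 - p) * exp (k (1 - 1)) + (1 - (1 - p)) * exp (k (1 - 0)))
      * ((1 - p) * exp (- h0) + (1 - (1 - p)) * exp (- h1)) \<le> 1"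
  proof (rule two_point_ordered)
    fix x y t :: real
    assume "0 \<le> t" "t \<le> 1"
    moreover have "1 - ((1 - t) * x + t * y) = (1 - t) * (1 - x) + t * (1 - y)"
      by (simp add: algebra_simps)
    ultimately show "k (1 - ((1 - t) * x + t * y)) \<le> (1 - t) * k (1 - x) + t * k (1 - y)"
      using cvx by metis
  next
    fix s show "k (1 - s) \<le> h1 + s\<^sup>2 / 8" using h1[of "1 - s"] by simp
    show "k (1 - s) \<le> h0 + (s - 1)\<^sup>2 / 8"
      using h0[of "1 - s"] by (simp add: power2_commute)
  qed (use p False in auto)
  then show ?thesis by (simp add: algebra_simps)
qed (rule two_point_ordered[OF assms])

lemma expectation_exp_pos:
  fixes f :: "'a \<Rightarrow> real"
  assumes "finite (set_pmf M)"
  shows "0 < measure_pmf.expectation M (\<lambda>x. exp (f x))"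
  using integrable_measure_pmf_finite[OF assms]
  by (intro measure_pmf.expectation_greater) (auto simp: AE_measure_pmf_iff)

text \<open>Normalising both integrands to mean one reduces Hoelder's inequality to the convexity of
  the exponential function.\<close>

lemma ln_expectation_exp_convex:
  fixes u v w :: "'a \<Rightarrow> real"
  assumes fin: "finite (set_pmf M)" and t: "0 \<le> t" "t \<le> 1"
    and w: "\<And>x. w x \<le> (1 - t) * u x + t * v x"
  shows "ln (measure_pmf.expectation M (\<lambda>x. exp (w x))) \<le>
    (1 - t) * ln (measure_pmf.expectation M (\<lambda>x. exp (u x))) +
    t * ln (measure_pmf.expectation M (\<lambda>x. exp (v x)))"
proof -
  have int [simp]: "integrable (measure_pmf M) f" for f :: "'a \<Rightarrow> real"
    using fin by (rule integrable_measure_pmf_finite)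
  note pos = expectation_exp_pos[OF fin]
  define a b where "a = ln (measure_pmf.expectation M (\<lambda>x. exp (u x)))"
    and "b = ln (measure_pmf.expectation M (\<lambda>x. exp (v x)))"
  have ab: "exp a = measure_pmf.expectation M (\<lambda>x. exp (u x))"
    "exp b = measure_pmf.expectation M (\<lambda>x. exp (v x))"
    using pos by (auto simp: a_def b_def)
  have "exp (w x) \<le>
      exp ((1 - t) * a + t * b) * ((1 - t) * (exp (u x) / exp a) + t * (exp (v x) / exp b))" for x
  proof -
    have "exp (w x) \<le> exp ((1 - t) * u x + t * v x)" using w by simp
    also have "\<dots> = exp ((1 - t) * a + t * b) * exp ((1 - t) * (u x - a) + t * (v x - b))"
      by (simp add: algebra_simps flip: exp_add)
    also have "exp ((1 - t) * (u x - a) + t * (v x - b)) \<le>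
        (1 - t) * exp (u x - a) + t * exp (v x - b)"
      using convex_onD[OF exp_convex, of t "u x - a" "v x - b"] t by simp
    finally show ?thesis by (simp add: exp_diff)
  qed
  then have "measure_pmf.expectation M (\<lambda>x. exp (w x)) \<le> measure_pmf.expectation M (\<lambda>x.
      exp ((1 - t) * a + t * b) * ((1 - t) * (exp (u x) / exp a) + t * (exp (v x) / exp b)))"
    by (intro integral_mono) auto
  also have "\<dots> = exp ((1 - t) * a + t * b) * ((1 - t) * (exp a / exp a) + t * (exp b / exp b))"
    by (simp add: ab)
  also have "\<dots> = exp ((1 - t) * a + t * b)" by simp
  finally have "ln (measure_pmf.expectation M (\<lambda>x. exp (w x))) \<le> ln (exp ((1 - t) * a + t * b))"
    using pos by (subst ln_le_cancel_iff) auto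
  then show ?thesis by (simp add: a_def b_def)
qed

section \<open>Concentration of convex Lipschitz functions\<close>

text \<open>A version of Maurey's convex property \<open>(\<tau>)\<close>. In the induction step the logarithm of the inner
  expectation of \<open>exp q\<close> is again convex in the new coordinate, which is why convexity is demanded
  of \<open>q\<close> and not of \<open>g\<close>.\<close>

lemma bernoulli_property_tau:
  fixes q :: "('a \<Rightarrow> real) \<Rightarrow> real" and g :: "('a \<Rightarrow> bool) \<Rightarrow> real"
  assumes "finite E" and p: "0 \<le> p" "p \<le> 1"
    and "\<And>x y t. 0 \<le> t \<Longrightarrow> t \<le> 1 \<Longrightarrow>
      q (\<lambda>e. (1 - t) * x e + t * y e) \<le> (1 - t) * q x + t * q y"
    and "\<And>x \<omega>. q x \<le> g \<omega> + (\<Sum>e\<in>E. (x e - of_bool (\<omega> e))\<^sup>2) / 8"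
  shows "measure_pmf.expectation (bernoulli_product E p) (\<lambda>\<omega>. exp (q (\<lambda>e. of_bool (\<omega> e)))) *
    measure_pmf.expectation (bernoulli_product E p) (\<lambda>\<omega>. exp (- g \<omega>)) \<le> 1"
  using assms(1,4,5)
proof (induction E arbitrary: q g rule: finite_induct)
  case empty
  have "q (\<lambda>e. of_bool False) \<le> g (\<lambda>_. False) + 0 / 8"
    using empty(2)[of "\<lambda>e. 0" "\<lambda>_. False"] by simp
  then show ?case by (simp flip: exp_add)
next
  case (insert e E)
  let ?E = "measure_pmf.expectation (bernoulli_product E p)"
  \<comment> \<open>The new coordinate is frozen, at a real \<open>s\<close> in \<open>K\<close> and
    at a bit \<open>b\<close> in \<open>H\<close>. In the two-point inequality \<open>ln K\<close>
    takes the place of \<open>k\<close>, and \<open>- ln H\<close> that of \<open>h0\<close> and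
    \<open>h1\<close>.\<close>
  define K where "K s = ?E (\<lambda>\<omega>. exp (q (fun_upd (\<lambda>e. of_bool (\<omega> e)) e s)))" for s :: real
  define H where "H b = ?E (\<lambda>\<omega>. exp (- g (fun_upd \<omega> e b)))" for b
  have pos: "?E (\<lambda>x. exp (f x)) > 0" for f :: "_ \<Rightarrow> real"
    using insert.hyps(1) by (intro expectation_exp_pos) simp
  have K: "K s > 0" for s unfolding K_def by (rule pos)
  have H: "H b > 0" for b unfolding H_def by (rule pos)
  have comb: "fun_upd (\<lambda>a. (1 - t) * x a + t * y a) e ((1 - t) * s + t * r) =
      (\<lambda>a. (1 - t) * (fun_upd x e s) a + t * (fun_upd y e r) a)" for x y :: "'a \<Rightarrow> real" and s r t
    by auto
  have cvx: "ln (K ((1 - t) * x + t * y)) \<le> (1 - t) * ln (K x) + t * ln (K y)"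
    if "0 \<le> t" "t \<le> 1" for x y t
    unfolding K_def
  proof (rule ln_expectation_exp_convex)
    fix \<omega> :: "'a \<Rightarrow> bool"
    have *: "(1 - t) * of_bool (\<omega> e) + t * of_bool (\<omega> e) = (of_bool (\<omega> e) :: real)" for e
      by (simp add: algebra_simps)
    show "q (fun_upd (\<lambda>e. of_bool (\<omega> e)) e ((1 - t) * x + t * y)) \<le>
        (1 - t) * q (fun_upd (\<lambda>e. of_bool (\<omega> e)) e x) +
        t * q (fun_upd (\<lambda>e. of_bool (\<omega> e)) e y)"
      using insert.prems(1)[OF that, of "fun_upd (\<lambda>e. of_bool (\<omega> e)) e x"
          "fun_upd (\<lambda>e. of_bool (\<omega> e)) e y"]
      unfolding comb[symmetric] * .
  qed (use that insert.hyps in auto)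
  \<comment> \<open>With \<open>s\<close> and \<open>b\<close> fixed, the quadratic cost of the new
    coordinate is a constant \<open>c\<close>. Subtracting it from \<open>q\<close> leaves exactly
    the hypothesis over the smaller index set.\<close>
  have bound: "ln (K s) \<le> - ln (H b) + (s - of_bool b)\<^sup>2 / 8" for s b
  proof -
    define c where "c = (s - of_bool b)\<^sup>2 / 8"
    let ?q = "\<lambda>x. q (fun_upd x e s) - c"
    have "?E (\<lambda>\<omega>. exp (?q (\<lambda>e. of_bool (\<omega> e)))) * ?E (\<lambda>\<omega>. exp (- g (fun_upd \<omega> e b))) \<le> 1"
    proof (rule insert.IH)
      fix x y :: "'a \<Rightarrow> real" and t :: real
      assume t: "0 \<le> t" "t \<le> 1"
      have eq: "fun_upd (\<lambda>a. (1 - t) * x a + t * y a) e s =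
          (\<lambda>a. (1 - t) * (fun_upd x e s) a + t * (fun_upd y e s) a)"
        by (auto simp: algebra_simps)
      show "?q (\<lambda>e. (1 - t) * x e + t * y e) \<le> (1 - t) * ?q x + t * ?q y"
      proof -
        have "q (fun_upd (\<lambda>e. (1 - t) * x e + t * y e) e s) \<le>
            (1 - t) * q (fun_upd x e s) + t * q (fun_upd y e s)"
          unfolding eq by (rule insert.prems(1)[OF t])
        then show ?thesis by (simp add: algebra_simps)
      qed
    next
      fix x \<omega>
      have "q (fun_upd x e s) \<le> g (fun_upd \<omega> e b) +
          (\<Sum>a\<in>insert e E. ((fun_upd x e s) a - of_bool ((fun_upd \<omega> e b) a))\<^sup>2) / 8"
        by (rule insert.prems(2))
      moreover have "(\<Sum>a\<in>E. ((fun_upd x e s) a - of_bool ((fun_upd \<omega> e b) a))\<^sup>2) =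
          (\<Sum>a\<in>E. (x a - of_bool (\<omega> a))\<^sup>2)"
        using insert.hyps by (intro sum.cong) auto
      then have "(\<Sum>a\<in>insert e E. ((fun_upd x e s) a - of_bool ((fun_upd \<omega> e b) a))\<^sup>2) / 8 =
          c + (\<Sum>a\<in>E. (x a - of_bool (\<omega> a))\<^sup>2) / 8"
        using insert.hyps by (simp add: c_def add_divide_distrib)
      ultimately show "?q x \<le> g (fun_upd \<omega> e b) + (\<Sum>e\<in>E. (x e - of_bool (\<omega> e))\<^sup>2) / 8"
        by linarith
    qed
    also have "?E (\<lambda>\<omega>. exp (?q (\<lambda>e. of_bool (\<omega> e)))) = K s * exp (- (c))"
      unfolding K_def by (simp add: exp_diff exp_minus divide_inverse)
    finally have "K s * exp (- (c)) * H b \<le> 1"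
      unfolding H_def .
    then have "ln (K s * exp (- (c)) * H b) \<le> 0"
      using K[of s] H[of b] by (subst ln_le_zero_iff) auto
    also have "ln (K s * exp (- (c)) * H b) =
        ln (K s) - c + ln (H b)"
      using K[of s] H[of b] by (simp add: ln_mult)
    finally show ?thesis by (simp add: c_def)
  qed
  have "(p * exp (ln (K 1)) + (1 - p) * exp (ln (K 0))) *
      (p * exp (- (- ln (H True))) + (1 - p) * exp (- (- ln (H False)))) \<le> 1"
    using cvx bound[of _ False] bound[of _ True] by (intro two_point p) auto
  then have "(p * K 1 + (1 - p) * K 0) * (p * H True + (1 - p) * H False) \<le> 1"
    using K H by simp
  moreover have "(\<lambda>a. of_bool ((fun_upd \<omega> e b) a)) = fun_upd (\<lambda>a. of_bool (\<omega> a) :: real) e (of_bool b)"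
    for \<omega> :: "'a \<Rightarrow> bool" and b
    by auto
  ultimately show ?case
    using insert.hyps p by (simp add: expectation_bernoulli_product_insert K_def H_def)
qed

text \<open>For a point at distance r from the cube point, a L r \<le> 2 a^2 L^2 + r^2 / 8, because
  (4 a L - r)^2 \<ge> 0. Hence \<open>a * f\<close> lowered by 2 a^2 L^2 satisfies the quadratic
  domination required by \<open>bernoulli_property_tau\<close>, with \<open>a * f\<close> on the
  cube as \<open>g\<close>.\<close>

lemma bernoulli_convex_lipschitz_exp:
  fixes f :: "('a \<Rightarrow> real) \<Rightarrow> real"
  assumes fin: "finite E" and p: "0 \<le> p" "p \<le> 1"
    and cvx: "\<And>x y t. 0 \<le> t \<Longrightarrow> t \<le> 1 \<Longrightarrow>
      f (\<lambda>e. (1 - t) * x e + t * y e) \<le> (1 - t) * f x + t * f y"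
    and lip: "\<And>x y. f x - f y \<le> L * sqrt (\<Sum>e\<in>E. (x e - y e)\<^sup>2)"
    and a: "0 \<le> a"
  shows "measure_pmf.expectation (bernoulli_product E p)
      (\<lambda>\<omega>. exp (a * f (\<lambda>e. of_bool (\<omega> e)))) *
    measure_pmf.expectation (bernoulli_product E p)
      (\<lambda>\<omega>. exp (- (a * f (\<lambda>e. of_bool (\<omega> e))))) \<le> exp (2 * a\<^sup>2 * L\<^sup>2)"
proof -
  let ?E = "measure_pmf.expectation (bernoulli_product E p)"
  let ?X = "\<lambda>\<omega> e. of_bool (\<omega> e) :: real"
  have "?E (\<lambda>\<omega>. exp (a * f (?X \<omega>) - 2 * a\<^sup>2 * L\<^sup>2)) * ?E (\<lambda>\<omega>. exp (- (a * f (?X \<omega>)))) \<le> 1"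
  proof (rule bernoulli_property_tau[OF fin p])
    fix x y :: "'a \<Rightarrow> real" and t :: real
    assume t: "0 \<le> t" "t \<le> 1"
    show "a * f (\<lambda>e. (1 - t) * x e + t * y e) - 2 * a\<^sup>2 * L\<^sup>2 \<le>
        (1 - t) * (a * f x - 2 * a\<^sup>2 * L\<^sup>2) + t * (a * f y - 2 * a\<^sup>2 * L\<^sup>2)"
      using mult_left_mono[OF cvx[OF t, of x y] a] by (simp add: algebra_simps)
  next
    fix x :: "'a \<Rightarrow> real" and \<omega> :: "'a \<Rightarrow> bool"
    define r where "r = sqrt (\<Sum>e\<in>E. (x e - ?X \<omega> e)\<^sup>2)"
    have r2: "r\<^sup>2 = (\<Sum>e\<in>E. (x e - ?X \<omega> e)\<^sup>2)"
      by (simp add: r_def sum_nonneg)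
    have "a * (f x - f (?X \<omega>)) \<le> a * (L * r)"
      unfolding r_def by (intro mult_left_mono lip a)
    also have "\<dots> \<le> 2 * a\<^sup>2 * L\<^sup>2 + r\<^sup>2 / 8"
      using zero_le_power2[of "4 * a * L - r"] by (simp add: power2_eq_square algebra_simps)
    finally show "a * f x - 2 * a\<^sup>2 * L\<^sup>2 \<le>
        a * f (?X \<omega>) + (\<Sum>e\<in>E. (x e - of_bool (\<omega> e))\<^sup>2) / 8"
      by (simp add: r2 algebra_simps)
  qed
  moreover have "?E (\<lambda>\<omega>. exp (a * f (?X \<omega>) - 2 * a\<^sup>2 * L\<^sup>2)) =
      ?E (\<lambda>\<omega>. exp (a * f (?X \<omega>))) / exp (2 * a\<^sup>2 * L\<^sup>2)"
    by (simp add: exp_diff)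
  ultimately show ?thesis by (simp add: divide_le_eq)
qed

text \<open>Jensen's inequality bounds the upper exponential moment from below, so that the previous
  lemma controls the lower one.\<close>

lemma bernoulli_convex_lower_tail:
  fixes f :: "('a \<Rightarrow> real) \<Rightarrow> real"
  assumes fin: "finite E" and p: "0 \<le> p" "p \<le> 1"
    and cvx: "\<And>x y t. 0 \<le> t \<Longrightarrow> t \<le> 1 \<Longrightarrow>
      f (\<lambda>e. (1 - t) * x e + t * y e) \<le> (1 - t) * f x + t * f y"
    and lip: "\<And>x y. f x - f y \<le> L * sqrt (\<Sum>e\<in>E. (x e - y e)\<^sup>2)"
    and L: "0 < L" and m: "0 \<le> m"
    and mean: "m \<le> measure_pmf.expectation (bernoulli_product E p) (\<lambda>\<omega>. f (\<lambda>e. of_bool (\<omega> e)))"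
  shows "measure_pmf.prob (bernoulli_product E p) {\<omega>. f (\<lambda>e. of_bool (\<omega> e)) \<le> m / 2}
    \<le> exp (- m\<^sup>2 / (32 * L\<^sup>2))"
proof -
  let ?M = "bernoulli_product E p"
  let ?E = "measure_pmf.expectation ?M"
  define Y where "Y \<omega> = f (\<lambda>e. of_bool (\<omega> e))" for \<omega>
  \<comment> \<open>This value minimises 2 a^2 L^2 - a m / 2, the exponent left after Markov's
    inequality.\<close>
  define a where "a = m / (8 * L\<^sup>2)"
  have a: "0 \<le> a" using m by (simp add: a_def)
  have int [simp]: "integrable (measure_pmf ?M) h" for h :: "_ \<Rightarrow> real"
    using fin by simp
  \<comment> \<open>Jensen's inequality by way of the tangent to the exponential at
    \<open>a * m\<close>, so that only the lower bound \<open>m\<close> on the mean enters.\<close>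
  have "exp (a * m) * 1 \<le> exp (a * m) * (1 + a * (?E Y - m))"
    using a mean unfolding Y_def by (intro mult_left_mono) auto
  also have "\<dots> = ?E (\<lambda>\<omega>. exp (a * m) * (1 + a * (Y \<omega> - m)))"
    by simp
  also have "\<dots> \<le> ?E (\<lambda>\<omega>. exp (a * Y \<omega>))"
  proof (rule expectation_mono_bernoulli_product[OF fin])
    fix \<omega>
    have "exp (a * m) * (1 + a * (Y \<omega> - m)) \<le> exp (a * m) * exp (a * (Y \<omega> - m))"
      by (intro mult_left_mono exp_ge_add_one_self) auto
    also have "\<dots> = exp (a * Y \<omega>)" by (simp add: right_diff_distrib flip: exp_add)
    finally show "exp (a * m) * (1 + a * (Y \<omega> - m)) \<le> exp (a * Y \<omega>)" .
  qed
  finally have up: "exp (a * m) \<le> ?E (\<lambda>\<omega>. exp (a * Y \<omega>))" by simp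
  have low0: "0 \<le> ?E (\<lambda>\<omega>. exp (- (a * Y \<omega>)))"
    by (intro Bochner_Integration.integral_nonneg) auto
  have "exp (a * m) * ?E (\<lambda>\<omega>. exp (- (a * Y \<omega>))) \<le>
      ?E (\<lambda>\<omega>. exp (a * Y \<omega>)) * ?E (\<lambda>\<omega>. exp (- (a * Y \<omega>)))"
    using up low0 by (rule mult_right_mono)
  also have "\<dots> \<le> exp (2 * a\<^sup>2 * L\<^sup>2)"
    unfolding Y_def using bernoulli_convex_lipschitz_exp[OF fin p cvx lip a] by simp
  finally have low: "?E (\<lambda>\<omega>. exp (- (a * Y \<omega>))) \<le> exp (2 * a\<^sup>2 * L\<^sup>2 - a * m)"
    by (simp add: exp_diff field_simps)
  have "measure_pmf.prob ?M {\<omega>. Y \<omega> \<le> m / 2} = ?E (indicator {\<omega>. Y \<omega> \<le> m / 2})"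
    by simp
  also have "\<dots> \<le> ?E (\<lambda>\<omega>. exp (a * m / 2) * exp (- (a * Y \<omega>)))"
  proof (rule expectation_mono_bernoulli_product[OF fin])
    fix \<omega>
    have "a * Y \<omega> \<le> a * (m / 2)" if "Y \<omega> \<le> m / 2"
      using that a by (intro mult_left_mono)
    then show "indicator {\<omega>. Y \<omega> \<le> m / 2} \<omega> \<le> exp (a * m / 2) * exp (- (a * Y \<omega>))"
      by (auto simp: indicator_def simp flip: exp_add)
  qed
  also have "\<dots> = exp (a * m / 2) * ?E (\<lambda>\<omega>. exp (- (a * Y \<omega>)))"
    by simp
  also have "\<dots> \<le> exp (a * m / 2) * exp (2 * a\<^sup>2 * L\<^sup>2 - a * m)"
    using low by (intro mult_left_mono) auto
  also have "\<dots> = exp (2 * a\<^sup>2 * L\<^sup>2 - a * m / 2)"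
    by (simp flip: exp_add)
  also have "2 * a\<^sup>2 * L\<^sup>2 - a * m / 2 = - m\<^sup>2 / (32 * L\<^sup>2)"
    using L by (simp add: a_def power2_eq_square field_simps)
  finally show ?thesis by (simp add: Y_def)
qed

section \<open>Characteristic functions and first absolute moments\<close>

text \<open>By the half-angle formula the left-over is 2 (sin v)^2 with v = u/2, and the cubic
  Taylor remainder gives \<bar>sin v\<bar> \<ge> 3/4 \<bar>v\<bar> on the unit interval.\<close>

lemma one_minus_cos_ge:
  fixes u :: real
  assumes "\<bar>u\<bar> \<le> 1"
  shows "u\<^sup>2 / 4 \<le> 1 - cos u"
proof -
  define v where "v = u / 2"
  have v: "\<bar>v\<bar> \<le> 1" using assms by (simp add: v_def)
  have "\<bar>sin v - (\<Sum>m<3. sin_coeff m * v ^ m)\<bar> \<le> inverse (fact 3) * \<bar>v\<bar> ^ 3"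
    by (rule Maclaurin_sin_bound)
  then have "\<bar>sin v - v\<bar> \<le> \<bar>v\<bar> ^ 3 / 6"
    by (simp add: sin_coeff_def eval_nat_numeral)
  moreover have "\<bar>v\<bar> ^ 3 \<le> \<bar>v\<bar> ^ 1"
    using v by (intro power_decreasing) auto
  ultimately have "3 / 4 * \<bar>v\<bar> \<le> \<bar>sin v\<bar>"
    unfolding power_one_right by linarith
  then have "(3 / 4 * \<bar>v\<bar>)\<^sup>2 \<le> \<bar>sin v\<bar>\<^sup>2"
    by (intro power_mono) auto
  then have "9 / 16 * v\<^sup>2 \<le> (sin v)\<^sup>2"
    by (simp add: power_mult_distrib power_divide)
  moreover have "1 - cos u = 2 * (sin v)\<^sup>2"
    using cos_double_sin[of v] by (simp add: v_def)
  moreover have "u\<^sup>2 / 4 = v\<^sup>2"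
    by (simp add: v_def power_divide)
  ultimately show ?thesis
    using zero_le_power2[of v] by linarith
qed

text \<open>The squared modulus equals 1 - 2 p (1 - p) (1 - cos u), to which 1 + x \<le> exp x
  applies.\<close>

lemma norm_bernoulli_char_le:
  assumes "0 \<le> p" "p \<le> 1"
  shows "norm (p *\<^sub>R cis u + (1 - p) *\<^sub>R 1) \<le> exp (- (p * (1 - p) * (1 - cos u)))"
proof -
  have "(norm (p *\<^sub>R cis u + (1 - p) *\<^sub>R 1))\<^sup>2 = (p * cos u + (1 - p))\<^sup>2 + (p * sin u)\<^sup>2"
    by (simp add: cmod_power2)
  also have "\<dots> = p\<^sup>2 * ((cos u)\<^sup>2 + (sin u)\<^sup>2) + (1 - p)\<^sup>2 + 2 * p * (1 - p) * cos u"
    by (simp only: power2_eq_square algebra_simps)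
  also have "\<dots> = 1 + (- (2 * (p * (1 - p) * (1 - cos u))))"
    by (simp add: power2_eq_square algebra_simps)
  also have "\<dots> \<le> exp (- (2 * (p * (1 - p) * (1 - cos u))))"
    by (rule exp_ge_add_one_self)
  also have "\<dots> = (exp (- (p * (1 - p) * (1 - cos u))))\<^sup>2"
    by (simp add: power2_eq_square flip: exp_add)
  finally show ?thesis
    by (rule power2_le_imp_le) auto
qed

text \<open>Since \<open>s \<bar>X\<bar> \<ge> 1 - cos (s X)\<close>, decay of the characteristic function at the scale
  \<open>s = 1 / \<surd>p\<close> bounds the first absolute moment from below.\<close>

lemma bernoulli_sum_abs_moment_ge:
  fixes a :: "'a \<Rightarrow> real"
  assumes fin: "finite E" and p: "0 < p" "p \<le> 1"
    and a: "\<And>e. e \<in> E \<Longrightarrow> \<bar>a e\<bar> \<le> sqrt p"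
  shows "sqrt p * (1 - exp (- ((1 - p) * (\<Sum>e\<in>E. (a e)\<^sup>2) / 4)))
    \<le> measure_pmf.expectation (bernoulli_product E p) (\<lambda>\<omega>. \<bar>\<Sum>e\<in>E. of_bool (\<omega> e) * a e\<bar>)"
proof -
  let ?M = "bernoulli_product E p"
  let ?E = "measure_pmf.expectation ?M"
  define s where "s = 1 / sqrt p"
  have s: "s > 0" using p by (simp add: s_def)
  define X where "X \<omega> = (\<Sum>e\<in>E. of_bool (\<omega> e) * a e)" for \<omega>
  have "(\<Prod>e\<in>E. if \<omega> e then cis (s * a e) else 1) = cis (s * X \<omega>)" for \<omega>
  proof -
    have "(\<Prod>e\<in>E. if \<omega> e then cis (s * a e) else 1) =
        (\<Prod>e\<in>E. exp (\<i> * of_real (s * (of_bool (\<omega> e) * a e))))"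
      by (intro prod.cong) (auto simp: cis_conv_exp)
    also have "\<dots> = exp (\<Sum>e\<in>E. \<i> * of_real (s * (of_bool (\<omega> e) * a e)))"
      using fin by (rule exp_sum[symmetric])
    also have "(\<Sum>e\<in>E. \<i> * of_real (s * (of_bool (\<omega> e) * a e))) = \<i> * of_real (s * X \<omega>)"
      unfolding X_def by (simp only: sum_distrib_left of_real_sum)
    also have "exp \<dots> = cis (s * X \<omega>)"
      by (simp add: cis_conv_exp)
    finally show ?thesis .
  qed
  then have char: "measure_pmf.expectation ?M (\<lambda>\<omega>. cis (s * X \<omega>)) =
      (\<Prod>e\<in>E. p *\<^sub>R cis (s * a e) + (1 - p) *\<^sub>R 1)"
    using expectation_prod_bernoulli_product[OF fin, of p "\<lambda>e b. if b then cis (s * a e) else 1"] p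
    by simp
  have "?E (\<lambda>\<omega>. cos (s * X \<omega>)) = Re (measure_pmf.expectation ?M (\<lambda>\<omega>. cis (s * X \<omega>)))"
    using integral_Re[of ?M "\<lambda>\<omega>. cis (s * X \<omega>)"] fin by simp
  also have "\<dots> \<le> norm (\<Prod>e\<in>E. p *\<^sub>R cis (s * a e) + (1 - p) *\<^sub>R 1)"
    unfolding char by (rule complex_Re_le_cmod)
  also have "\<dots> \<le> (\<Prod>e\<in>E. exp (- (p * (1 - p) * (1 - cos (s * a e)))))"
    unfolding prod_norm[symmetric] using p by (intro prod_mono conjI norm_bernoulli_char_le) auto
  also have "\<dots> \<le> (\<Prod>e\<in>E. exp (- ((1 - p) * (a e)\<^sup>2 / 4)))"
  proof (intro prod_mono conjI)
    fix e assume e: "e \<in> E"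
    \<comment> \<open>The size condition on the coefficients puts the argument into the range of the
      quadratic bound on the cosine; afterwards the factor p cancels against s^2 = 1/p.\<close>
    have "\<bar>s * a e\<bar> \<le> 1"
      using a[OF e] p by (simp add: s_def abs_mult divide_le_eq)
    then have "(s * a e)\<^sup>2 / 4 \<le> 1 - cos (s * a e)"
      by (rule one_minus_cos_ge)
    then have "p * (1 - p) * ((s * a e)\<^sup>2 / 4) \<le> p * (1 - p) * (1 - cos (s * a e))"
      using p by (intro mult_left_mono) auto
    moreover have "p * (1 - p) * ((s * a e)\<^sup>2 / 4) = (1 - p) * (a e)\<^sup>2 / 4"
      using p by (simp add: s_def power_mult_distrib power_divide)
    ultimately show "exp (- (p * (1 - p) * (1 - cos (s * a e)))) \<le> exp (- ((1 - p) * (a e)\<^sup>2 / 4))"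
      unfolding exp_le_cancel_iff neg_le_iff_le by linarith
  qed auto
  also have "\<dots> = exp (- ((1 - p) * (\<Sum>e\<in>E. (a e)\<^sup>2) / 4))"
    using fin by (simp add: sum_distrib_left sum_divide_distrib sum_negf flip: exp_sum)
  finally have cos: "?E (\<lambda>\<omega>. cos (s * X \<omega>)) \<le> exp (- ((1 - p) * (\<Sum>e\<in>E. (a e)\<^sup>2) / 4))" .
  have "1 - cos x \<le> \<bar>x\<bar>" for x :: real
  proof -
    have "1 - cos x = 2 * (\<bar>sin (x / 2)\<bar> * \<bar>sin (x / 2)\<bar>)"
      using cos_double_sin[of "x / 2"] by (simp add: power2_eq_square)
    also have "\<dots> \<le> 2 * (\<bar>x / 2\<bar> * 1)"
      by (intro mult_left_mono mult_mono abs_sin_x_le_abs_x abs_sin_le_one) auto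
    finally show ?thesis by simp
  qed
  then have "?E (\<lambda>\<omega>. 1 - cos (s * X \<omega>)) \<le> ?E (\<lambda>\<omega>. \<bar>s * X \<omega>\<bar>)"
    by (rule expectation_mono_bernoulli_product[OF fin])
  then have "1 - ?E (\<lambda>\<omega>. cos (s * X \<omega>)) \<le> s * ?E (\<lambda>\<omega>. \<bar>X \<omega>\<bar>)"
    using s fin by (simp add: abs_mult)
  then have "1 - exp (- ((1 - p) * (\<Sum>e\<in>E. (a e)\<^sup>2) / 4)) \<le> s * ?E (\<lambda>\<omega>. \<bar>X \<omega>\<bar>)"
    using cos by linarith
  then have "sqrt p * (1 - exp (- ((1 - p) * (\<Sum>e\<in>E. (a e)\<^sup>2) / 4))) \<le> sqrt p * (s * ?E (\<lambda>\<omega>. \<bar>X \<omega>\<bar>))"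
    using p by (intro mult_left_mono) auto
  also have "\<dots> = ?E (\<lambda>\<omega>. \<bar>X \<omega>\<bar>)"
    using p by (simp add: s_def)
  finally show ?thesis by (simp add: X_def)
qed

section \<open>The two-dimensional discrete Fourier transform\<close>

text \<open>The entries of \<open>fourier_matrix\<close> as a function on all naturals, so that sums
  can be manipulated free of matrix index bounds.\<close>

definition dft :: "nat \<Rightarrow> nat \<Rightarrow> nat \<Rightarrow> complex" where
  "dft N m x = complex_of_real (1 / sqrt (real N)) *
     exp (- (2 * complex_of_real pi * \<i> * of_nat m * of_nat x / of_nat N))"

lemma dft_commute: "dft N m x = dft N x m"
  by (simp add: dft_def mult_ac)

lemma norm_dft: "cmod (dft N m x) = 1 / sqrt (real N)"
proof -
  have "exp (- (2 * complex_of_real pi * \<i> * of_nat m * of_nat x / of_nat N)) =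
      cis (- (2 * pi * real m * real x / real N))"
    by (simp add: cis_conv_exp mult_ac)
  then show ?thesis by (simp add: dft_def norm_mult norm_divide)
qed

text \<open>Off the diagonal the sum is geometric, with ratio an N-th root of unity different from
  1.\<close>

lemma dft_orthogonal:
  assumes "0 < N" "x < N" "y < N"
  shows "(\<Sum>m<N. dft N m x * cnj (dft N m y)) = of_bool (x = y)"
proof (cases "x = y")
  case True
  have "dft N m y * cnj (dft N m y) = of_real (1 / N)" for m
    using norm_dft[of N m y] by (simp add: power_divide flip: complex_norm_square)
  then show ?thesis using True assms by simp
next
  case False
  define w where "w k = exp (2 * of_real pi * \<i> * of_nat k / of_nat N)" for k :: nat
  define z where "z = w y / w x"
  have wN: "w k ^ N = 1" for k
    unfolding w_def using assms by (intro complex_root_unity) auto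
  have w0: "w k \<noteq> 0" for k by (simp add: w_def)
  have "w y \<noteq> w x"
    unfolding w_def using complex_root_unity_eq[of N y x] assms False by auto
  then have z1: "z \<noteq> 1" using w0 by (simp add: z_def)
  have zN: "z ^ N = 1" by (simp add: z_def power_divide wN)
  have pow: "w k ^ m = exp (2 * of_real pi * \<i> * of_nat m * of_nat k / of_nat N)" for k m
    unfolding w_def by (simp add: mult_ac flip: exp_of_nat_mult)
  have "dft N m x * cnj (dft N m y) = of_real (1 / N) * z ^ m" for m
  proof -
    have "cnj (exp (- (2 * complex_of_real pi * \<i> * of_nat m * of_nat y / of_nat N))) = w y ^ m"
      by (simp add: pow exp_cnj)
    moreover have "exp (- (2 * complex_of_real pi * \<i> * of_nat m * of_nat x / of_nat N)) =
        1 / w x ^ m"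
      by (simp add: pow exp_minus divide_inverse)
    moreover have "complex_of_real (1 / sqrt N) * complex_of_real (1 / sqrt N) = of_real (1 / N)"
      by (simp flip: of_real_mult)
    ultimately show ?thesis
      by (simp add: dft_def z_def power_divide)
  qed
  then have "(\<Sum>m<N. dft N m x * cnj (dft N m y)) = of_real (1 / N) * (\<Sum>m<N. z ^ m)"
    by (simp add: sum_distrib_left)
  also have "(\<Sum>m<N. z ^ m) = 0"
    using z1 zN by (simp add: sum_gp_strict)
  finally show ?thesis using False by simp
qed

lemma dft_parseval:
  assumes "0 < N"
  shows "(\<Sum>m<N. (cmod (\<Sum>x<N. dft N m x * b x))\<^sup>2) = (\<Sum>x<N. (cmod (b x))\<^sup>2)"
proof -
  have "complex_of_real (\<Sum>m<N. (cmod (\<Sum>x<N. dft N m x * b x))\<^sup>2) =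
      (\<Sum>m<N. (\<Sum>x<N. dft N m x * b x) * cnj (\<Sum>x<N. dft N m x * b x))"
    unfolding of_real_sum complex_norm_square ..
  also have "\<dots> = (\<Sum>m<N. \<Sum>x<N. \<Sum>y<N. b x * cnj (b y) * (dft N m x * cnj (dft N m y)))"
    by (simp add: sum_product mult_ac)
  also have "\<dots> = (\<Sum>x<N. \<Sum>m<N. \<Sum>y<N. b x * cnj (b y) * (dft N m x * cnj (dft N m y)))"
    by (rule sum.swap)
  also have "\<dots> = (\<Sum>x<N. \<Sum>y<N. \<Sum>m<N. b x * cnj (b y) * (dft N m x * cnj (dft N m y)))"
    by (intro sum.cong refl sum.swap)
  also have "\<dots> = (\<Sum>x<N. \<Sum>y<N. b x * cnj (b y) * of_bool (x = y))"
    using assms by (intro sum.cong refl) (simp add: dft_orthogonal flip: sum_distrib_left)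
  also have "\<dots> = (\<Sum>x<N. b x * cnj (b x))"
    by (intro sum.cong refl) (simp add: if_distrib[of "\<lambda>t. _ * t"] of_bool_def cong: if_cong)
  also have "\<dots> = complex_of_real (\<Sum>x<N. (cmod (b x))\<^sup>2)"
    unfolding of_real_sum complex_norm_square ..
  finally show ?thesis by (simp only: of_real_eq_iff)
qed

text \<open>One-dimensional Parseval applied once in each variable. The symmetry of the kernel turns
  right multiplication by F into a transform of the rows.\<close>

lemma dft_parseval2:
  assumes "0 < N"
  shows "(\<Sum>m<N. \<Sum>n<N. (cmod (\<Sum>x<N. \<Sum>y<N. dft N m x * a x y * dft N y n))\<^sup>2) =
    (\<Sum>x<N. \<Sum>y<N. (cmod (a x y))\<^sup>2)"
proof -
  define c where "c n x = (\<Sum>y<N. dft N n y * a x y)" for n x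
  have "(\<Sum>x<N. \<Sum>y<N. dft N m x * a x y * dft N y n) = (\<Sum>x<N. dft N m x * c n x)" for m n
    by (simp add: c_def sum_distrib_left dft_commute[of N n] mult_ac)
  then have "(\<Sum>m<N. \<Sum>n<N. (cmod (\<Sum>x<N. \<Sum>y<N. dft N m x * a x y * dft N y n))\<^sup>2) =
      (\<Sum>m<N. \<Sum>n<N. (cmod (\<Sum>x<N. dft N m x * c n x))\<^sup>2)"
    by simp
  also have "\<dots> = (\<Sum>n<N. \<Sum>m<N. (cmod (\<Sum>x<N. dft N m x * c n x))\<^sup>2)"
    by (rule sum.swap)
  also have "\<dots> = (\<Sum>n<N. \<Sum>x<N. (cmod (c n x))\<^sup>2)"
    using assms by (simp add: dft_parseval)
  also have "\<dots> = (\<Sum>x<N. \<Sum>n<N. (cmod (c n x))\<^sup>2)"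
    by (rule sum.swap)
  also have "\<dots> = (\<Sum>x<N. \<Sum>y<N. (cmod (a x y))\<^sup>2)"
    using assms unfolding c_def by (simp add: dft_parseval)
  finally show ?thesis .
qed

lemma mult_mat_index_sum:
  assumes "A \<in> carrier_mat N N" "B \<in> carrier_mat N N" "m < N" "n < N"
  shows "(A * B) $$ (m, n) = (\<Sum>x<N. A $$ (m, x) * B $$ (x, n))"
  using assms by (auto simp: scalar_prod_def atLeast0LessThan intro!: sum.cong)

lemma fourier_transform_index:
  assumes "M \<in> carrier_mat N N" "m < N" "n < N"
  shows "(fourier_matrix N * M * fourier_matrix N) $$ (m, n) =
    (\<Sum>x<N. \<Sum>y<N. dft N m x * M $$ (x, y) * dft N y n)"
proof -
  have F: "fourier_matrix N \<in> carrier_mat N N" by (simp add: fourier_matrix_def)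
  have F_index: "fourier_matrix N $$ (i, j) = dft N i j" if "i < N" "j < N" for i j
    using that by (simp add: fourier_matrix_def dft_def)
  have FM: "(fourier_matrix N * M) $$ (m, y) = (\<Sum>x<N. dft N m x * M $$ (x, y))" if "y < N" for y
    using assms that by (simp add: mult_mat_index_sum[OF F] F_index)
  have "(fourier_matrix N * M * fourier_matrix N) $$ (m, n) =
      (\<Sum>y<N. (fourier_matrix N * M) $$ (m, y) * dft N y n)"
    using assms by (simp add: mult_mat_index_sum[OF mult_carrier_mat[OF F] F] F_index)
  also have "\<dots> = (\<Sum>y<N. \<Sum>x<N. dft N m x * M $$ (x, y) * dft N y n)"
    by (simp add: FM sum_distrib_right)
  also have "\<dots> = (\<Sum>x<N. \<Sum>y<N. dft N m x * M $$ (x, y) * dft N y n)"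
    by (rule sum.swap)
  finally show ?thesis .
qed

section \<open>Edges as pairs of labels\<close>

definition pairs :: "nat \<Rightarrow> (nat \<times> nat) set" where
  "pairs N = (SIGMA x:{..<N}. {..<x})"

lemma sum_square_pairs:
  fixes h :: "nat \<Rightarrow> nat \<Rightarrow> 'a :: ab_group_add"
  shows "(\<Sum>x<N. \<Sum>y<N. h x y) = (\<Sum>x<N. h x x) + (\<Sum>(x, y)\<in>pairs N. h x y + h y x)"
proof -
  have "(\<Sum>x<N. \<Sum>y<N. h x y) = (\<Sum>x<N. h x x) + (\<Sum>x<N. \<Sum>y<x. h x y + h y x)"
    by (induction N) (simp_all add: sum.distrib)
  then show ?thesis by (simp add: pairs_def sum.Sigma)
qed

text \<open>Here \<tau> is an inverse labeling, from labels to vertices. Each edge is hit exactly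
  once because its two labels are listed in decreasing order.\<close>

lemma bij_betw_pairs_edges:
  assumes \<tau>: "bij_betw \<tau> {..<N} {1..N}"
  shows "bij_betw (\<lambda>(x, y). {\<tau> x, \<tau> y}) (pairs N) (possible_edges N)"
proof -
  have inj: "inj_on \<tau> {..<N}" and img: "\<tau> ` {..<N} = {1..N}"
    using \<tau> by (auto simp: bij_betw_def)
  have eq: "\<tau> x = \<tau> y \<longleftrightarrow> x = y" if "x < N" "y < N" for x y
    using inj that by (auto simp: inj_on_def)
  have mem: "\<tau> x \<in> {1..N}" if "x < N" for x using img that by blast
  show ?thesis
    unfolding bij_betw_def
  proof (intro conjI equalityI subsetI)
    show "inj_on (\<lambda>(x, y). {\<tau> x, \<tau> y}) (pairs N)"
      by (auto simp: inj_on_def pairs_def doubleton_eq_iff eq)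
  next
    fix e assume "e \<in> (\<lambda>(x, y). {\<tau> x, \<tau> y}) ` pairs N"
    then show "e \<in> possible_edges N"
      using mem by (auto simp: pairs_def possible_edges_def eq card_insert_if)
  next
    fix e assume "e \<in> possible_edges N"
    then obtain a b where ab: "e = {a, b}" "a \<noteq> b" "a \<in> {1..N}" "b \<in> {1..N}"
      by (auto simp: possible_edges_def card_2_iff)
    then obtain x y where xy: "a = \<tau> x" "b = \<tau> y" "x < N" "y < N"
      unfolding img[symmetric] by auto
    moreover from this have "x \<noteq> y" using ab by auto
    ultimately have "(max x y, min x y) \<in> pairs N"
      by (auto simp: pairs_def max_def min_def)
    moreover have "e = (\<lambda>(x, y). {\<tau> x, \<tau> y}) (max x y, min x y)"
      using ab xy by (auto simp: max_def min_def)
    ultimately show "e \<in> (\<lambda>(x, y). {\<tau> x, \<tau> y}) ` pairs N" by blast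
  qed
qed

text \<open>The coefficient of the indicator of \<open>e\<close> in entry (m, n) of FAF. An edge
  fills two symmetric positions of A, whence the two summands.\<close>

definition edge_coeff :: "nat \<Rightarrow> (nat \<Rightarrow> nat) \<Rightarrow> nat \<Rightarrow> nat \<Rightarrow> nat set \<Rightarrow> complex" where
  "edge_coeff N \<tau> m n e =
     (case inv_into (pairs N) (\<lambda>(x, y). {\<tau> x, \<tau> y}) e of
       (x, y) \<Rightarrow> dft N m x * dft N y n + dft N m y * dft N x n)"

text \<open>The summand \<open>g\<close> is left general so that one reindexing serves the transform
  itself, its Parseval identity and the squared coefficients.\<close>

lemma sum_edges_eq_sum_pairs:
  assumes \<tau>: "bij_betw \<tau> {..<N} {1..N}"
  shows "(\<Sum>e\<in>possible_edges N. g e (edge_coeff N \<tau> m n e)) =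
    (\<Sum>(x, y)\<in>pairs N. g {\<tau> x, \<tau> y} (dft N m x * dft N y n + dft N m y * dft N x n))"
proof -
  note bij = bij_betw_pairs_edges[OF \<tau>]
  have "(\<Sum>e\<in>possible_edges N. g e (edge_coeff N \<tau> m n e)) =
      (\<Sum>i\<in>pairs N. g (case i of (x, y) \<Rightarrow> {\<tau> x, \<tau> y})
        (edge_coeff N \<tau> m n (case i of (x, y) \<Rightarrow> {\<tau> x, \<tau> y})))"
    by (rule sum.reindex_bij_betw[OF bij, symmetric])
  also have "\<dots> = (\<Sum>(x, y)\<in>pairs N. g {\<tau> x, \<tau> y} (dft N m x * dft N y n + dft N m y * dft N x n))"
  proof (intro sum.cong refl)
    fix i assume i: "i \<in> pairs N"
    obtain x y where xy: "i = (x, y)" by (cases i)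
    have "inv_into (pairs N) (\<lambda>(x, y). {\<tau> x, \<tau> y}) {\<tau> x, \<tau> y} = (x, y)"
      using bij_betw_inv_into_left[OF bij i] by (simp add: xy)
    then show "g (case i of (x, y) \<Rightarrow> {\<tau> x, \<tau> y})
        (edge_coeff N \<tau> m n (case i of (x, y) \<Rightarrow> {\<tau> x, \<tau> y})) =
      (case i of (x, y) \<Rightarrow> g {\<tau> x, \<tau> y} (dft N m x * dft N y n + dft N m y * dft N x n))"
      by (simp add: xy edge_coeff_def)
  qed
  finally show ?thesis .
qed

lemma finite_possible_edges [simp]: "finite (possible_edges N)"
  unfolding possible_edges_def by (rule finite_subset[of _ "Pow {1..N}"]) auto

text \<open>The weights are real and not Boolean because convexity and the Lipschitz bound are
  needed off the vertices of the cube.\<close>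

definition edge_transform :: "nat \<Rightarrow> (nat \<Rightarrow> nat) \<Rightarrow> (nat set \<Rightarrow> real) \<Rightarrow> nat \<Rightarrow> nat \<Rightarrow> complex" where
  "edge_transform N \<tau> w m n = (\<Sum>e\<in>possible_edges N. of_real (w e) * edge_coeff N \<tau> m n e)"

lemma edge_transform_eq:
  assumes \<tau>: "bij_betw \<tau> {..<N} {1..N}"
  shows "edge_transform N \<tau> w m n =
    (\<Sum>x<N. \<Sum>y<N. dft N m x * (if x = y then 0 else of_real (w {\<tau> x, \<tau> y})) * dft N y n)"
  unfolding edge_transform_def sum_edges_eq_sum_pairs[OF \<tau>, of "\<lambda>e c. of_real (w e) * c"]
    sum_square_pairs
  by (auto simp: pairs_def insert_commute algebra_simps intro!: sum.cong)

lemma edge_transform_parseval: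
  assumes \<tau>: "bij_betw \<tau> {..<N} {1..N}" and N: "0 < N"
  shows "(\<Sum>m<N. \<Sum>n<N. (cmod (edge_transform N \<tau> w m n))\<^sup>2) = 2 * (\<Sum>e\<in>possible_edges N. (w e)\<^sup>2)"
proof -
  have "(\<Sum>m<N. \<Sum>n<N. (cmod (edge_transform N \<tau> w m n))\<^sup>2) =
      (\<Sum>x<N. \<Sum>y<N. (cmod (if x = y then 0 else of_real (w {\<tau> x, \<tau> y})))\<^sup>2)"
    unfolding edge_transform_eq[OF \<tau>] using N by (rule dft_parseval2)
  also have "\<dots> = (\<Sum>(x, y)\<in>pairs N. 2 * (w {\<tau> x, \<tau> y})\<^sup>2)"
    unfolding sum_square_pairs by (auto simp: pairs_def insert_commute intro!: sum.cong)
  also have "\<dots> = 2 * (\<Sum>e\<in>possible_edges N. (w e)\<^sup>2)"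
    using sum_edges_eq_sum_pairs[OF \<tau>, of "\<lambda>e _. 2 * (w e)\<^sup>2"]
    by (simp add: sum_distrib_left)
  finally show ?thesis .
qed

lemma norm_edge_coeff_le:
  shows "cmod (edge_coeff N \<tau> m n e) \<le> 2 / N"
proof -
  have "cmod (dft N a b * dft N c d) = 1 / N" for a b c d
    by (simp add: norm_mult norm_dft)
  then show ?thesis
    unfolding edge_coeff_def
    by (auto split: prod.split intro!: order_trans[OF norm_triangle_ineq])
qed

text \<open>Over all ordered pairs the squares of \<open>u x y + u y x\<close> sum to 2 plus a
  nonnegative cross term. Removing the diagonal contribution 4/N and halving, since each edge occurs
  in both orders, leaves at least 1 - 2/N.\<close>

lemma sum_norm_edge_coeff_ge:
  assumes \<tau>: "bij_betw \<tau> {..<N} {1..N}" and N: "0 < N"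
  shows "1 - 2 / N \<le> (\<Sum>e\<in>possible_edges N. (cmod (edge_coeff N \<tau> m n e))\<^sup>2)"
proof -
  let ?u = "\<lambda>x y. dft N m x * dft N y n"
  have u: "(cmod (?u x y))\<^sup>2 = 1 / (real N)\<^sup>2" for x y
    by (simp add: norm_mult norm_dft power_divide)
  \<comment> \<open>The cross term factors into a complex number times its own conjugate, hence is
    nonnegative.\<close>
  have "(\<Sum>x<N. \<Sum>y<N. ?u x y * cnj (?u y x)) =
      (\<Sum>x<N. dft N m x * cnj (dft N x n)) * (\<Sum>y<N. cnj (dft N m y) * dft N y n)"
    unfolding sum_product by (intro sum.cong refl) (simp add: mult_ac)
  also have "\<dots> = (\<Sum>x<N. dft N m x * cnj (dft N x n)) * cnj (\<Sum>x<N. dft N m x * cnj (dft N x n))"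
    by simp
  also have "\<dots> = of_real ((cmod (\<Sum>x<N. dft N m x * cnj (dft N x n)))\<^sup>2)"
    by (simp only: complex_norm_square)
  finally have cross: "0 \<le> (\<Sum>x<N. \<Sum>y<N. Re (?u x y * cnj (?u y x)))"
    by (simp flip: Re_sum del: times_complex.simps)
  have sq: "(cmod (a + b))\<^sup>2 = (cmod a)\<^sup>2 + (cmod b)\<^sup>2 + 2 * Re (a * cnj b)" for a b :: complex
    unfolding cmod_power2 by (simp add: power2_eq_square algebra_simps)
  have "(\<Sum>x<N. \<Sum>y<N. (cmod (?u x y + ?u y x))\<^sup>2) =
      (\<Sum>x<N. \<Sum>y<N. 2 / (real N)\<^sup>2) + 2 * (\<Sum>x<N. \<Sum>y<N. Re (?u x y * cnj (?u y x)))"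
    unfolding sq u by (simp only: sum.distrib sum_distrib_left) simp
  then have "2 \<le> (\<Sum>x<N. \<Sum>y<N. (cmod (?u x y + ?u y x))\<^sup>2)"
    using cross N by (simp add: power2_eq_square)
  also have "\<dots> = (\<Sum>x<N. (cmod (?u x x + ?u x x))\<^sup>2) + 2 * (\<Sum>(x, y)\<in>pairs N. (cmod (?u x y + ?u y x))\<^sup>2)"
    unfolding sum_square_pairs sum_distrib_left by (auto simp: add.commute intro!: sum.cong)
  also have "(\<Sum>x<N. (cmod (?u x x + ?u x x))\<^sup>2) = 4 / N"
    using N unfolding mult_2[symmetric] norm_mult[of 2] power_mult_distrib u
    by (simp add: power2_eq_square)
  also have "(\<Sum>(x, y)\<in>pairs N. (cmod (?u x y + ?u y x))\<^sup>2) =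
      (\<Sum>e\<in>possible_edges N. (cmod (edge_coeff N \<tau> m n e))\<^sup>2)"
    using sum_edges_eq_sum_pairs[OF \<tau>, of "\<lambda>_ c. (cmod c)\<^sup>2"] by simp
  finally show ?thesis by simp
qed

section \<open>Fourier norms of random adjacency matrices\<close>

text \<open>Cauchy--Schwarz over the N^2 entries. It yields both the Lipschitz constant and the
  upper bound N on the Fourier ratio.\<close>

lemma l1_le_frobenius:
  fixes N :: nat
  shows "(\<Sum>m<N. \<Sum>n<N. cmod (g m n)) \<le> N * sqrt (\<Sum>m<N. \<Sum>n<N. (cmod (g m n))\<^sup>2)"
proof (rule power2_le_imp_le)
  let ?I = "{..<N} \<times> {..<N}"
  have "(\<Sum>m<N. \<Sum>n<N. cmod (g m n))\<^sup>2 = (\<Sum>(m, n)\<in>?I. cmod (g m n))\<^sup>2"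
    by (simp add: sum.cartesian_product)
  also have "\<dots> \<le> (\<Sum>(m, n)\<in>?I. (cmod (g m n))\<^sup>2) * card ?I"
    using sum_squared_le_sum_of_squares[where I = ?I and f = "\<lambda>(m, n). cmod (g m n)"]
    by (simp add: case_prod_unfold)
  also have "\<dots> = (N * sqrt (\<Sum>m<N. \<Sum>n<N. (cmod (g m n))\<^sup>2))\<^sup>2"
    by (simp add: power_mult_distrib sum_nonneg)
      (simp add: sum.cartesian_product power2_eq_square)
  finally show "(\<Sum>m<N. \<Sum>n<N. cmod (g m n))\<^sup>2 \<le> (N * sqrt (\<Sum>m<N. \<Sum>n<N. (cmod (g m n))\<^sup>2))\<^sup>2" .
qed (auto intro!: mult_nonneg_nonneg sum_nonneg)

definition edge_l1 :: "nat \<Rightarrow> (nat \<Rightarrow> nat) \<Rightarrow> (nat set \<Rightarrow> real) \<Rightarrow> real" where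
  "edge_l1 N \<tau> w = (\<Sum>m<N. \<Sum>n<N. cmod (edge_transform N \<tau> w m n))"

lemma edge_transform_lincomb:
  "edge_transform N \<tau> (\<lambda>e. a * x e + b * y e) m n =
    of_real a * edge_transform N \<tau> x m n + of_real b * edge_transform N \<tau> y m n"
  by (simp add: edge_transform_def sum_distrib_left sum.distrib algebra_simps)

lemma edge_l1_convex:
  assumes "0 \<le> t" "t \<le> 1"
  shows "edge_l1 N \<tau> (\<lambda>e. (1 - t) * x e + t * y e) \<le> (1 - t) * edge_l1 N \<tau> x + t * edge_l1 N \<tau> y"
proof -
  have "cmod (edge_transform N \<tau> (\<lambda>e. (1 - t) * x e + t * y e) m n) \<le>
      (1 - t) * cmod (edge_transform N \<tau> x m n) + t * cmod (edge_transform N \<tau> y m n)" for m n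
  proof -
    have "cmod (edge_transform N \<tau> (\<lambda>e. (1 - t) * x e + t * y e) m n) \<le>
        cmod (of_real (1 - t) * edge_transform N \<tau> x m n) + cmod (of_real t * edge_transform N \<tau> y m n)"
      unfolding edge_transform_lincomb by (rule norm_triangle_ineq)
    then show ?thesis using assms by (simp add: norm_mult del: of_real_diff)
  qed
  then have "edge_l1 N \<tau> (\<lambda>e. (1 - t) * x e + t * y e) \<le>
      (\<Sum>m<N. \<Sum>n<N. (1 - t) * cmod (edge_transform N \<tau> x m n) + t * cmod (edge_transform N \<tau> y m n))"
    unfolding edge_l1_def by (intro sum_mono)
  then show ?thesis
    by (simp add: edge_l1_def sum.distrib sum_distrib_left)
qed

text \<open>The factor N comes from Cauchy--Schwarz and the factor \<surd>2 from Parseval, where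
  each edge counts twice.\<close>

lemma edge_l1_lipschitz:
  assumes \<tau>: "bij_betw \<tau> {..<N} {1..N}" and N: "0 < N"
  shows "edge_l1 N \<tau> x - edge_l1 N \<tau> y \<le>
    N * sqrt 2 * sqrt (\<Sum>e\<in>possible_edges N. (x e - y e)\<^sup>2)"
proof -
  have diff: "edge_transform N \<tau> (\<lambda>e. x e - y e) m n =
      edge_transform N \<tau> x m n - edge_transform N \<tau> y m n" for m n
    using edge_transform_lincomb[of N \<tau> 1 x "-1" y] by simp
  have "edge_l1 N \<tau> x - edge_l1 N \<tau> y =
      (\<Sum>m<N. \<Sum>n<N. cmod (edge_transform N \<tau> x m n) - cmod (edge_transform N \<tau> y m n))"
    by (simp add: edge_l1_def sum_subtractf)
  also have "\<dots> \<le> (\<Sum>m<N. \<Sum>n<N. cmod (edge_transform N \<tau> (\<lambda>e. x e - y e) m n))"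
    unfolding diff by (intro sum_mono norm_triangle_ineq2)
  also have "\<dots> \<le> N * sqrt (\<Sum>m<N. \<Sum>n<N. (cmod (edge_transform N \<tau> (\<lambda>e. x e - y e) m n))\<^sup>2)"
    by (rule l1_le_frobenius)
  also have "\<dots> = N * sqrt 2 * sqrt (\<Sum>e\<in>possible_edges N. (x e - y e)\<^sup>2)"
    by (simp add: edge_transform_parseval[OF \<tau> N] real_sqrt_mult)
  finally show ?thesis .
qed

text \<open>Only the values of \<tau> on the labels below \<open>N\<close> matter, so the union
  bound can run over a finite set of extensional functions.\<close>

lemma edge_l1_restrict:
  assumes \<tau>: "bij_betw \<tau> {..<N} {1..N}"
  shows "edge_l1 N (restrict \<tau> {..<N}) = edge_l1 N \<tau>"
proof -
  have "bij_betw (restrict \<tau> {..<N}) {..<N} {1..N}"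
    using \<tau> bij_betw_cong[of "{..<N}" "restrict \<tau> {..<N}" \<tau>] by simp
  then show ?thesis
    by (intro ext) (simp add: edge_l1_def edge_transform_eq \<tau> cong: if_cong)
qed

text \<open>The squared moduli of the coefficients sum to at least 1/2, so the real or the imaginary
  parts carry at least 1/4 of it. That part is a real Bernoulli sum with coefficients at most 2/N,
  and its absolute value is a lower bound for the modulus.\<close>

lemma edge_transform_abs_moment_ge:
  assumes \<tau>: "bij_betw \<tau> {..<N} {1..N}" and N: "4 \<le> N"
    and p: "0 < p" "p \<le> 1 - d" "0 \<le> d" "2 / N \<le> sqrt p"
  shows "sqrt p * (1 - exp (- d / 16)) \<le>
    measure_pmf.expectation (bernoulli_product (possible_edges N) p)
      (\<lambda>\<omega>. cmod (edge_transform N \<tau> (\<lambda>e. of_bool (\<omega> e)) m n))"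
proof -
  let ?E = "possible_edges N"
  let ?c = "edge_coeff N \<tau> m n"
  have "1 / 2 \<le> 1 - 2 / real N" using N by (simp add: field_simps)
  also have "\<dots> \<le> (\<Sum>e\<in>?E. (cmod (?c e))\<^sup>2)"
    using N by (intro sum_norm_edge_coeff_ge \<tau>) auto
  also have "\<dots> = (\<Sum>e\<in>?E. (Re (?c e))\<^sup>2) + (\<Sum>e\<in>?E. (Im (?c e))\<^sup>2)"
    by (simp add: cmod_power2 sum.distrib)
  finally have "1 / 4 \<le> (\<Sum>e\<in>?E. (Re (?c e))\<^sup>2) \<or> 1 / 4 \<le> (\<Sum>e\<in>?E. (Im (?c e))\<^sup>2)"
    by linarith
  then obtain R :: "complex \<Rightarrow> real" where R: "R = Re \<or> R = Im" and sum: "1 / 4 \<le> (\<Sum>e\<in>?E. (R (?c e))\<^sup>2)"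
    by blast
  have abs_R: "\<bar>R z\<bar> \<le> cmod z" for z
    using R abs_Re_le_cmod abs_Im_le_cmod by auto
  have R_sum: "(\<Sum>e\<in>?E. of_bool (\<omega> e) * R (?c e)) = R (edge_transform N \<tau> (\<lambda>e. of_bool (\<omega> e)) m n)" for \<omega>
    using R by (auto simp: edge_transform_def)
  have "d / 16 \<le> (1 - p) * (\<Sum>e\<in>?E. (R (?c e))\<^sup>2) / 4"
    using mult_mono[of d "1 - p" "1 / 4" "\<Sum>e\<in>?E. (R (?c e))\<^sup>2"] p sum by simp
  then have "sqrt p * (1 - exp (- d / 16)) \<le> sqrt p * (1 - exp (- ((1 - p) * (\<Sum>e\<in>?E. (R (?c e))\<^sup>2) / 4)))"
    using p by (intro mult_left_mono) auto
  also have "\<dots> \<le> measure_pmf.expectation (bernoulli_product ?E p) (\<lambda>\<omega>. \<bar>\<Sum>e\<in>?E. of_bool (\<omega> e) * R (?c e)\<bar>)"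
  proof (rule bernoulli_sum_abs_moment_ge)
    show "\<bar>R (?c e)\<bar> \<le> sqrt p" for e
      using abs_R[of "?c e"] norm_edge_coeff_le[of N \<tau> m n e] p by linarith
  qed (use p in auto)
  also have "\<dots> \<le> measure_pmf.expectation (bernoulli_product ?E p)
      (\<lambda>\<omega>. cmod (edge_transform N \<tau> (\<lambda>e. of_bool (\<omega> e)) m n))"
    unfolding R_sum by (intro expectation_mono_bernoulli_product abs_R) auto
  finally show ?thesis .
qed

lemma edge_l1_lower_tail:
  assumes \<tau>: "bij_betw \<tau> {..<N} {1..N}" and N: "4 \<le> N"
    and p: "0 < p" "p \<le> 1 - d" "0 \<le> d" "2 / N \<le> sqrt p"
  shows "measure_pmf.prob (bernoulli_product (possible_edges N) p)
      {\<omega>. edge_l1 N \<tau> (\<lambda>e. of_bool (\<omega> e)) \<le> (real N)\<^sup>2 * sqrt p * (1 - exp (- d / 16)) / 2}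
    \<le> exp (- (real N)\<^sup>2 * p * (1 - exp (- d / 16))\<^sup>2 / 64)"
proof -
  let ?M = "bernoulli_product (possible_edges N) p"
  \<comment> \<open>The moment bound summed over all N^2 entries. The squared Lipschitz constant is
    2 N^2, which turns the denominator 32 of the tail bound into 64 and leaves N^2 of the N^4 in
    \<open>m\<^sup>2\<close>.\<close>
  define m where "m = (real N)\<^sup>2 * sqrt p * (1 - exp (- d / 16))"
  have m0: "0 \<le> m" using p by (simp add: m_def)
  have "m = (\<Sum>i<N. \<Sum>j<N. sqrt p * (1 - exp (- d / 16)))"
    by (simp add: m_def power2_eq_square)
  also have "\<dots> \<le> (\<Sum>i<N. \<Sum>j<N. measure_pmf.expectation ?M
      (\<lambda>\<omega>. cmod (edge_transform N \<tau> (\<lambda>e. of_bool (\<omega> e)) i j)))"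
    by (intro sum_mono edge_transform_abs_moment_ge \<tau> N p)
  also have "\<dots> = measure_pmf.expectation ?M (\<lambda>\<omega>. edge_l1 N \<tau> (\<lambda>e. of_bool (\<omega> e)))"
    by (simp add: edge_l1_def)
  finally have mean: "m \<le> \<dots>" .
  have "measure_pmf.prob ?M {\<omega>. edge_l1 N \<tau> (\<lambda>e. of_bool (\<omega> e)) \<le> m / 2} \<le>
      exp (- m\<^sup>2 / (32 * (N * sqrt 2)\<^sup>2))"
    using p N m0 mean
    by (intro bernoulli_convex_lower_tail edge_l1_convex edge_l1_lipschitz \<tau>) auto
  also have "- m\<^sup>2 / (32 * (N * sqrt 2)\<^sup>2) = - (real N)\<^sup>2 * p * (1 - exp (- d / 16))\<^sup>2 / 64"
  proof -
    have "m\<^sup>2 = (real N)\<^sup>2 * ((real N)\<^sup>2 * p * (1 - exp (- d / 16))\<^sup>2)"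
      using p by (simp add: m_def power_mult_distrib power4_eq_xxxx power2_eq_square)
    then show ?thesis using N by (simp add: power_mult_distrib)
  qed
  finally show ?thesis by (simp add: m_def)
qed

section \<open>The number of edges\<close>

lemma card_possible_edges_le: "real (card (possible_edges N)) \<le> (real N)\<^sup>2 / 2"
proof -
  have "card (possible_edges N) = N choose 2"
    using n_subsets[of "{1..N}" 2] by (simp add: possible_edges_def)
  then have "2 * card (possible_edges N) \<le> N * (N - 1)"
    by (simp add: choose_two)
  then have "real (2 * card (possible_edges N)) \<le> real (N * (N - 1))"
    by (rule of_nat_mono)
  then have "real (card (possible_edges N)) \<le> real (N * (N - 1)) / 2"
    by simp
  also have "\<dots> \<le> (real N)\<^sup>2 / 2"
    unfolding power2_eq_square of_nat_mult by (intro divide_right_mono mult_left_mono) auto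
  finally show ?thesis .
qed

text \<open>Chernoff's method with exponential parameter 1. Since exp 1 - 1 \<le> 2 and there are at
  most N^2 / 2 possible edges, the moment generating function is at most exp (N^2 p), half of the
  exponent at the threshold.\<close>

lemma edge_count_upper_tail:
  assumes p: "0 \<le> p" "p \<le> 1"
  shows "measure_pmf.prob (bernoulli_product (possible_edges N) p)
      {\<omega>. 2 * (real N)\<^sup>2 * p \<le> (\<Sum>e\<in>possible_edges N. of_bool (\<omega> e))}
    \<le> exp (- (real N)\<^sup>2 * p)"
proof -
  let ?E = "possible_edges N"
  let ?M = "bernoulli_product ?E p"
  define K where "K = 2 * (real N)\<^sup>2 * p"
  define S where "S \<omega> = (\<Sum>e\<in>?E. of_bool (\<omega> e) :: real)" for \<omega>
  have "measure_pmf.expectation ?M (\<lambda>\<omega>. exp (S \<omega>)) =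
      measure_pmf.expectation ?M (\<lambda>\<omega>. \<Prod>e\<in>?E. exp (of_bool (\<omega> e)))"
    unfolding S_def by (subst exp_sum) auto
  also have "\<dots> = (1 + p * (exp 1 - 1)) ^ card ?E"
    using expectation_prod_bernoulli_product[of ?E p "\<lambda>_ b. exp (of_bool b :: real)"] p
    by (simp add: algebra_simps)
  also have "\<dots> \<le> exp (p * (exp 1 - 1)) ^ card ?E"
    using p by (intro power_mono exp_ge_add_one_self) auto
  also have "\<dots> = exp (p * (exp 1 - 1) * card ?E)"
    by (simp add: mult.commute flip: exp_of_nat_mult)
  also have "\<dots> \<le> exp (p * 2 * ((real N)\<^sup>2 / 2))"
    unfolding exp_le_cancel_iff using p exp_le card_possible_edges_le[of N]
    by (intro mult_mono mult_left_mono) auto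
  finally have mgf: "measure_pmf.expectation ?M (\<lambda>\<omega>. exp (S \<omega>)) \<le> exp ((real N)\<^sup>2 * p)"
    by (simp add: mult.commute)
  have "measure_pmf.prob ?M {\<omega>. K \<le> S \<omega>} = measure_pmf.expectation ?M (indicator {\<omega>. K \<le> S \<omega>})"
    by simp
  also have "\<dots> \<le> measure_pmf.expectation ?M (\<lambda>\<omega>. exp (- K) * exp (S \<omega>))"
    by (rule expectation_mono_bernoulli_product) (auto simp: indicator_def simp flip: exp_add)
  also have "\<dots> = exp (- K) * measure_pmf.expectation ?M (\<lambda>\<omega>. exp (S \<omega>))"
    by simp
  also have "\<dots> \<le> exp (- K) * exp ((real N)\<^sup>2 * p)"
    using mgf by (intro mult_left_mono) auto
  also have "\<dots> = exp (- (real N)\<^sup>2 * p)"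
    by (simp add: K_def flip: exp_add)
  finally show ?thesis by (simp add: K_def S_def)
qed

section \<open>Fourier ratios in terms of edge indicators\<close>

lemma fourier_ratio_le:
  assumes "M \<in> carrier_mat N N"
  shows "fourier_ratio M \<le> N"
proof -
  define T where "T = fourier_matrix N * M * fourier_matrix N"
  have dim: "dim_row M = N" "dim_row T = N" "dim_col T = N"
    using assms by (auto simp: T_def fourier_matrix_def)
  have "entrywise_l1_norm T \<le> N * frobenius_norm T"
    unfolding entrywise_l1_norm_def frobenius_norm_def dim by (rule l1_le_frobenius)
  moreover have "0 \<le> frobenius_norm T"
    by (simp add: frobenius_norm_def sum_nonneg)
  \<comment> \<open>If the transform vanishes, the quotient is 0 by the convention for division, and
    the bound still holds.\<close>
  ultimately show ?thesis
    by (cases "frobenius_norm T = 0")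
      (auto simp: fourier_ratio_def Let_def dim divide_le_eq simp flip: T_def)
qed

text \<open>By Parseval the denominator depends only on the number of edges, so the labeling enters
  through the numerator alone.\<close>

lemma fourier_ratio_adjacency_matrix:
  fixes N :: nat and \<omega> :: "nat set \<Rightarrow> bool"
  defines "G \<equiv> ({1..N}, {e \<in> possible_edges N. \<omega> e})"
  assumes \<sigma>: "vertex_labeling G \<sigma>" and N: "0 < N"
  shows "fourier_ratio (adjacency_matrix G \<sigma>) =
    edge_l1 N (inv_into {1..N} \<sigma>) (\<lambda>e. of_bool (\<omega> e)) /
      sqrt (2 * (\<Sum>e\<in>possible_edges N. of_bool (\<omega> e)))"
proof -
  define \<tau> where "\<tau> = inv_into {1..N} \<sigma>"
  define A where "A = adjacency_matrix G \<sigma>"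
  have \<sigma>: "bij_betw \<sigma> {1..N} {..<N}"
    using \<sigma> by (simp add: vertex_labeling_def G_def)
  have \<tau>: "bij_betw \<tau> {..<N} {1..N}"
    unfolding \<tau>_def using \<sigma> by (rule bij_betw_inv_into)
  have edge: "{\<tau> x, \<tau> y} \<in> possible_edges N \<longleftrightarrow> x \<noteq> y" if "x < N" "y < N" for x y
  proof -
    have "\<tau> x \<in> {1..N}" "\<tau> y \<in> {1..N}" "\<tau> x = \<tau> y \<longleftrightarrow> x = y"
      using \<tau> that by (auto simp: bij_betw_def inj_on_def)
    then show ?thesis by (auto simp: possible_edges_def card_insert_if)
  qed
  \<comment> \<open>Each label belongs to exactly one vertex, which collapses the existential
    quantifiers in \<open>adjacency_matrix\<close>.\<close>
  have label: "u \<in> {1..N} \<and> \<sigma> u = x \<longleftrightarrow> u = \<tau> x" if "x < N" for u x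
    unfolding \<tau>_def using \<sigma> that
    by (metis bij_betw_inv_into_left bij_betw_inv_into_right bij_betw_apply bij_betw_inv_into lessThan_iff)
  have A: "A \<in> carrier_mat N N"
    by (simp add: A_def adjacency_matrix_def G_def)
  have "(\<exists>u\<in>{1..N}. \<exists>v\<in>{1..N}. \<sigma> u = x \<and> \<sigma> v = y \<and> {u, v} \<in> snd G) \<longleftrightarrow>
      x \<noteq> y \<and> \<omega> {\<tau> x, \<tau> y}" if "x < N" "y < N" for x y
  proof -
    have "(\<exists>u\<in>{1..N}. \<exists>v\<in>{1..N}. \<sigma> u = x \<and> \<sigma> v = y \<and> {u, v} \<in> snd G) \<longleftrightarrow>
        (\<exists>u v. (u \<in> {1..N} \<and> \<sigma> u = x) \<and> (v \<in> {1..N} \<and> \<sigma> v = y) \<and> {u, v} \<in> snd G)"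
      by blast
    also have "\<dots> \<longleftrightarrow> x \<noteq> y \<and> \<omega> {\<tau> x, \<tau> y}"
      unfolding label[OF that(1)] label[OF that(2)] using edge[OF that] by (auto simp: G_def)
    finally show ?thesis .
  qed
  then have A_index: "A $$ (x, y) = (if x = y then 0 else of_real (of_bool (\<omega> {\<tau> x, \<tau> y})))"
    if "x < N" "y < N" for x y
    using that by (simp add: A_def adjacency_matrix_def G_def)
  define T where "T = fourier_matrix N * A * fourier_matrix N"
  have T: "T $$ (m, n) = edge_transform N \<tau> (\<lambda>e. of_bool (\<omega> e)) m n" if "m < N" "n < N" for m n
    using that unfolding T_def fourier_transform_index[OF A that] edge_transform_eq[OF \<tau>]
    by (simp add: A_index cong: if_cong)
  have dim: "dim_row A = N" "dim_row T = N" "dim_col T = N"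
    using A by (auto simp: T_def fourier_matrix_def)
  have "entrywise_l1_norm T = edge_l1 N \<tau> (\<lambda>e. of_bool (\<omega> e))"
    by (simp add: entrywise_l1_norm_def dim T edge_l1_def)
  moreover have "frobenius_norm T = sqrt (2 * (\<Sum>e\<in>possible_edges N. of_bool (\<omega> e)))"
  proof -
    have "(\<Sum>e\<in>possible_edges N. (of_bool (\<omega> e) :: real)\<^sup>2) = (\<Sum>e\<in>possible_edges N. of_bool (\<omega> e))"
      by (intro sum.cong refl) (simp add: of_bool_def)
    moreover have "(\<Sum>m<N. \<Sum>n<N. (cmod (T $$ (m, n)))\<^sup>2) =
        (\<Sum>m<N. \<Sum>n<N. (cmod (edge_transform N \<tau> (\<lambda>e. of_bool (\<omega> e)) m n))\<^sup>2)"
      by (intro sum.cong refl) (simp add: T)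
    ultimately show ?thesis
      using edge_transform_parseval[OF \<tau> N, of "\<lambda>e. of_bool (\<omega> e)"]
      by (simp only: frobenius_norm_def dim)
  qed
  ultimately show ?thesis
    by (simp add: fourier_ratio_def Let_def dim \<tau>_def flip: A_def T_def)
qed

section \<open>Edge complexity\<close>

text \<open>A real number strictly between the limit superior and 1 supplies the margin
  \<delta>.\<close>

lemma limsup_less_one_iff:
  fixes p :: "nat \<Rightarrow> real"
  shows "limsup (\<lambda>N. ereal (p N)) < 1 \<longleftrightarrow> (\<exists>\<delta>>0. \<forall>\<^sub>F N in sequentially. p N \<le> 1 - \<delta>)"
proof
  assume "limsup (\<lambda>N. ereal (p N)) < 1"
  then obtain y where y: "limsup (\<lambda>N. ereal (p N)) < y" "y < 1"
    using dense by blast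
  then obtain r where r: "y = ereal r" "r < 1"
    by (cases y) auto
  have "\<forall>\<^sub>F N in sequentially. ereal (p N) < y"
    using y(1) by (rule Limsup_lessD)
  then have "\<forall>\<^sub>F N in sequentially. p N \<le> 1 - (1 - r)"
    by eventually_elim (simp add: r)
  then show "\<exists>\<delta>>0. \<forall>\<^sub>F N in sequentially. p N \<le> 1 - \<delta>"
    using r(2) by (intro exI[of _ "1 - r"]) auto
next
  assume "\<exists>\<delta>>0. \<forall>\<^sub>F N in sequentially. p N \<le> 1 - \<delta>"
  then obtain \<delta> where \<delta>: "\<delta> > 0" "\<forall>\<^sub>F N in sequentially. p N \<le> 1 - \<delta>" by blast
  have "limsup (\<lambda>N. ereal (p N)) \<le> ereal (1 - \<delta>)"
    by (rule Limsup_bounded) (use \<delta>(2) in \<open>auto elim: eventually_mono\<close>)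
  also have "\<dots> < 1" using \<delta>(1) by simp
  finally show "limsup (\<lambda>N. ereal (p N)) < 1" .
qed

text \<open>The deterministic part, valid outside the bad events. Strictness in \<open>l1\<close>
  excludes the empty graph, whose transform vanishes, and so keeps the Frobenius norm
  positive.\<close>

lemma edge_complexity_bounds:
  fixes N :: nat and \<omega> :: "nat set \<Rightarrow> bool"
  defines "G \<equiv> ({1..N}, {e \<in> possible_edges N. \<omega> e})"
  assumes N: "0 < N" and a: "0 \<le> a" and b: "0 < b"
    and l1: "\<And>\<tau>. bij_betw \<tau> {..<N} {1..N} \<Longrightarrow> a < edge_l1 N \<tau> (\<lambda>e. of_bool (\<omega> e))"
    and count: "(\<Sum>e\<in>possible_edges N. of_bool (\<omega> e)) \<le> b"
  shows "snd G \<noteq> {}" "a / sqrt (2 * b) \<le> edge_complexity G" "edge_complexity G \<le> N"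
proof -
  let ?S = "\<Sum>e\<in>possible_edges N. of_bool (\<omega> e) :: real"
  have fin: "finite (fst G)" and card: "card (fst G) = N" by (auto simp: G_def)
  note finR = finite_labeling_fourier_ratios[OF fin] and neR = labeling_fourier_ratios_nonempty[OF fin]
  have bij: "bij_betw (inv_into {1..N} \<sigma>) {..<N} {1..N}" if "vertex_labeling G \<sigma>" for \<sigma>
    using that by (intro bij_betw_inv_into) (simp add: vertex_labeling_def G_def)
  obtain \<sigma> where \<sigma>: "vertex_labeling G \<sigma>"
    using neR by (auto simp: labeling_fourier_ratios_def)
  show ne: "snd G \<noteq> {}"
  proof
    assume "snd G = {}"
    then have "edge_l1 N (inv_into {1..N} \<sigma>) (\<lambda>e. of_bool (\<omega> e)) = 0"
      by (simp add: G_def edge_l1_def edge_transform_def)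
    then show False using l1[OF bij[OF \<sigma>]] a by simp
  qed
  have S: "0 < ?S"
  proof -
    obtain e where "e \<in> possible_edges N" "\<omega> e" using ne by (auto simp: G_def)
    then show ?thesis by (intro sum_pos2[of _ e]) auto
  qed
  show "a / sqrt (2 * b) \<le> edge_complexity G"
    unfolding edge_complexity_def Min_ge_iff[OF finR neR]
  proof
    fix r assume "r \<in> labeling_fourier_ratios G"
    then obtain \<sigma> where r: "r = fourier_ratio (adjacency_matrix G \<sigma>)" and \<sigma>: "vertex_labeling G \<sigma>"
      by (auto simp: labeling_fourier_ratios_def)
    have "a / sqrt (2 * b) \<le> edge_l1 N (inv_into {1..N} \<sigma>) (\<lambda>e. of_bool (\<omega> e)) / sqrt (2 * ?S)"
      using l1[OF bij[OF \<sigma>]] a S count by (intro frac_le) auto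
    also have "\<dots> = r"
      using fourier_ratio_adjacency_matrix[of N \<omega> \<sigma>] \<sigma> N by (simp add: r G_def)
    finally show "a / sqrt (2 * b) \<le> r" .
  qed
  have "edge_complexity G \<le> fourier_ratio (adjacency_matrix G \<sigma>)"
    unfolding edge_complexity_def using finR \<sigma>
    by (intro Min_le) (auto simp: labeling_fourier_ratios_def)
  also have "\<dots> \<le> N"
    by (rule fourier_ratio_le) (simp add: adjacency_matrix_def card)
  finally show "edge_complexity G \<le> N" .
qed

lemma prob_edge_complexity_ge:
  assumes N: "4 \<le> N" and p: "0 < p" "p \<le> 1 - d" "0 \<le> d" "2 / N \<le> sqrt p"
  defines "\<eta> \<equiv> 1 - exp (- d / 16)"
  shows "1 - (exp (- (real N)\<^sup>2 * p) + real N ^ N * exp (- (real N)\<^sup>2 * p * \<eta>\<^sup>2 / 64)) \<le>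
    measure_pmf.prob (erdos_renyi N p)
      {G. snd G \<noteq> {} \<and> \<eta> / 4 * real N \<le> edge_complexity G \<and> edge_complexity G \<le> real N}"
proof -
  let ?M = "bernoulli_product (possible_edges N) p"
  let ?good = "{G :: nat graph. snd G \<noteq> {} \<and> \<eta> / 4 * real N \<le> edge_complexity G \<and> edge_complexity G \<le> real N}"
  define a where "a = (real N)\<^sup>2 * sqrt p * \<eta> / 2"
  define b where "b = 2 * (real N)\<^sup>2 * p"
  define B0 where "B0 = {\<omega>. b \<le> (\<Sum>e\<in>possible_edges N. of_bool (\<omega> e) :: real)}"
  define B where "B \<tau> = {\<omega>. edge_l1 N \<tau> (\<lambda>e. of_bool (\<omega> e)) \<le> a}" for \<tau>
  \<comment> \<open>Extensionality makes the set of inverse labelings finite; the crude count N^N in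
    place of N! suffices for the union bound.\<close>
  define L where "L = {\<tau> \<in> {..<N} \<rightarrow>\<^sub>E {1..N}. bij_betw \<tau> {..<N} {1..N}}"
  have finL: "finite L" and cardL: "real (card L) \<le> real N ^ N"
  proof -
    have fin: "finite ({..<N} \<rightarrow>\<^sub>E {1..N})" by (intro finite_PiE) auto
    then show "finite L" by (simp add: L_def)
    have "card L \<le> card ({..<N} \<rightarrow>\<^sub>E {1..N})"
      unfolding L_def using fin by (intro card_mono) auto
    also have "\<dots> = N ^ N" by (simp add: card_PiE)
    finally show "real (card L) \<le> real N ^ N" by (metis of_nat_le_iff of_nat_power)
  qed
  have p1: "p \<le> 1" using p by simp
  have \<eta>: "0 \<le> \<eta>" using p by (simp add: \<eta>_def)
  have "measure_pmf.prob ?M (B0 \<union> (\<Union>\<tau>\<in>L. B \<tau>)) \<le>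
      measure_pmf.prob ?M B0 + measure_pmf.prob ?M (\<Union>\<tau>\<in>L. B \<tau>)"
    by (rule measure_Un_le) auto
  also have "\<dots> \<le> exp (- (real N)\<^sup>2 * p) + (\<Sum>\<tau>\<in>L. measure_pmf.prob ?M (B \<tau>))"
    using p p1 finL unfolding B0_def b_def
    by (intro add_mono edge_count_upper_tail measure_UNION_le) auto
  also have "(\<Sum>\<tau>\<in>L. measure_pmf.prob ?M (B \<tau>)) \<le> (\<Sum>\<tau>\<in>L. exp (- (real N)\<^sup>2 * p * \<eta>\<^sup>2 / 64))"
    unfolding B_def a_def \<eta>_def using N p
    by (intro sum_mono edge_l1_lower_tail) (auto simp: L_def)
  also have "\<dots> \<le> real N ^ N * exp (- (real N)\<^sup>2 * p * \<eta>\<^sup>2 / 64)"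
    using cardL by (simp add: mult_right_mono)
  finally have bad: "measure_pmf.prob ?M (B0 \<union> (\<Union>\<tau>\<in>L. B \<tau>)) \<le>
      exp (- (real N)\<^sup>2 * p) + real N ^ N * exp (- (real N)\<^sup>2 * p * \<eta>\<^sup>2 / 64)"
    by simp
  let ?G = "\<lambda>\<omega>. ({1..N}, {e \<in> possible_edges N. \<omega> e})"
  have "- (B0 \<union> (\<Union>\<tau>\<in>L. B \<tau>)) \<subseteq> ?G -` ?good"
  proof
    fix \<omega> assume \<omega>: "\<omega> \<in> - (B0 \<union> (\<Union>\<tau>\<in>L. B \<tau>))"
    have l1: "a < edge_l1 N \<tau> (\<lambda>e. of_bool (\<omega> e))" if \<tau>: "bij_betw \<tau> {..<N} {1..N}" for \<tau>
    proof -
      have "restrict \<tau> {..<N} \<in> L"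
        using \<tau> bij_betw_cong[of "{..<N}" "restrict \<tau> {..<N}" \<tau>]
        by (auto simp: L_def dest: bij_betwE)
      then have "a < edge_l1 N (restrict \<tau> {..<N}) (\<lambda>e. of_bool (\<omega> e))"
        using \<omega> by (auto simp: B_def not_le)
      then show ?thesis by (simp add: edge_l1_restrict[OF \<tau>])
    qed
    have count: "(\<Sum>e\<in>possible_edges N. of_bool (\<omega> e)) \<le> b"
      using \<omega> by (simp add: B0_def)
    \<comment> \<open>The edge bound 2 N^2 p gives Frobenius norm at most 2 N \<surd>p, against an
      entrywise norm above N^2 \<surd>p \<eta> / 2. This is the source of the constant
      \<eta>/4.\<close>
    have ab: "a / sqrt (2 * b) = \<eta> / 4 * real N"
    proof -
      have "sqrt (2 * b) = 2 * real N * sqrt p"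
        by (simp add: b_def real_sqrt_mult)
      then show ?thesis using p N by (simp add: a_def power2_eq_square)
    qed
    have "0 < N" "0 \<le> a" "0 < b" using p N \<eta> by (auto simp: a_def b_def)
    from edge_complexity_bounds[OF this l1 count, unfolded ab]
    show "\<omega> \<in> ?G -` ?good"
      unfolding vimage_eq mem_Collect_eq by (intro conjI)
  qed
  then have "measure_pmf.prob ?M (- (B0 \<union> (\<Union>\<tau>\<in>L. B \<tau>))) \<le> measure_pmf.prob ?M (?G -` ?good)"
    by (intro measure_pmf.finite_measure_mono) auto
  moreover have "measure_pmf.prob ?M (- (B0 \<union> (\<Union>\<tau>\<in>L. B \<tau>))) =
      1 - measure_pmf.prob ?M (B0 \<union> (\<Union>\<tau>\<in>L. B \<tau>))"
    using measure_pmf.prob_compl[of "B0 \<union> (\<Union>\<tau>\<in>L. B \<tau>)" ?M] by (simp add: Compl_eq_Diff_UNIV)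
  moreover have "measure_pmf.prob (erdos_renyi N p) ?good = measure_pmf.prob ?M (?G -` ?good)"
    unfolding erdos_renyi_def measure_map_pmf ..
  ultimately show ?thesis using bad by linarith
qed

lemma edge_complexity_whp:
  fixes p :: "nat \<Rightarrow> real"
  assumes p: "\<And>N. 0 \<le> p N" and d: "0 < d"
    and growth: "filterlim (\<lambda>N. real N * p N / ln (real N)) at_top sequentially"
    and upper: "\<forall>\<^sub>F N in sequentially. p N \<le> 1 - d"
  shows "(\<lambda>N. measure_pmf.prob (erdos_renyi N (p N))
      {G. snd G \<noteq> {} \<and> (1 - exp (- d / 16)) / 4 * real N \<le> edge_complexity G \<and>
        edge_complexity G \<le> real N}) \<longlonglongrightarrow> 1"
proof (rule tendsto_sandwich)
  define \<eta> where "\<eta> = 1 - exp (- d / 16)"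
  have \<eta>: "0 < \<eta>" "\<eta> \<le> 1" using d by (auto simp: \<eta>_def)
  \<comment> \<open>The constant is twice 64/\<eta>^2, so the tail exponent reaches 2 N ln N: one
    half cancels N^N = exp (N ln N), the other makes the union bound tend to 0.\<close>
  have "\<forall>\<^sub>F N in sequentially. 128 / \<eta>\<^sup>2 \<le> real N * p N / ln (real N)"
    using growth by (simp add: filterlim_at_top)
  then show "\<forall>\<^sub>F N in sequentially. 1 - 2 * exp (- real N) \<le>
      measure_pmf.prob (erdos_renyi N (p N))
      {G. snd G \<noteq> {} \<and> (1 - exp (- d / 16)) / 4 * real N \<le> edge_complexity G \<and>
        edge_complexity G \<le> real N}"
    using upper eventually_ge_at_top[of "4::nat"]
  proof eventually_elim
    case (elim N)
    have "exp 1 \<le> real N" using elim(3) exp_le by linarith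
    then have ln: "1 \<le> ln (real N)"
      using elim(3) by (subst ln_ge_iff) auto
    have sq: "1 \<le> 1 / \<eta>\<^sup>2" using \<eta> by (simp add: power_le_one)
    have Np: "128 / \<eta>\<^sup>2 * ln (real N) \<le> real N * p N"
      using elim(1) ln by (simp add: pos_le_divide_eq)
    have "1 * 1 \<le> 128 / \<eta>\<^sup>2 * ln (real N)"
      using sq ln by (intro mult_mono) auto
    then have Np1: "1 \<le> real N * p N" using Np by simp
    then have p0: "0 < p N" using elim(3) p[of N] by (cases "p N = 0") auto
    have N2p: "real N \<le> (real N)\<^sup>2 * p N"
      using mult_left_mono[OF Np1, of "real N"] by (simp add: power2_eq_square)
    \<comment> \<open>This is 4 \<le> N^2 p, which follows from N \<ge> 4 and N p \<ge> 1.\<close>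
    have "(2 / real N)\<^sup>2 \<le> p N"
      using N2p elim(3) by (simp add: power_divide divide_le_eq mult.commute)
    then have "2 / real N \<le> sqrt (p N)" by (rule real_le_rsqrt)
    then have *: "1 - (exp (- (real N)\<^sup>2 * p N) + real N ^ N * exp (- (real N)\<^sup>2 * p N * \<eta>\<^sup>2 / 64)) \<le>
      measure_pmf.prob (erdos_renyi N (p N))
        {G. snd G \<noteq> {} \<and> (1 - exp (- d / 16)) / 4 * real N \<le> edge_complexity G \<and>
          edge_complexity G \<le> real N}"
      unfolding \<eta>_def using elim d p0 by (intro prob_edge_complexity_ge) auto
    have "2 * (real N * ln (real N)) = real N * (128 / \<eta>\<^sup>2 * ln (real N)) * (\<eta>\<^sup>2 / 64)"
      using \<eta> by simp
    also have "\<dots> \<le> real N * (real N * p N) * (\<eta>\<^sup>2 / 64)"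
      using Np by (intro mult_right_mono mult_left_mono) auto
    also have "\<dots> = (real N)\<^sup>2 * p N * \<eta>\<^sup>2 / 64" by (simp add: power2_eq_square)
    finally have expo: "2 * (real N * ln (real N)) \<le> (real N)\<^sup>2 * p N * \<eta>\<^sup>2 / 64" .
    have "real N ^ N = exp (real N * ln (real N))"
      using elim(3) by (simp add: exp_of_nat_mult)
    then have "real N ^ N * exp (- (real N)\<^sup>2 * p N * \<eta>\<^sup>2 / 64) \<le> exp (- (real N * ln (real N)))"
      using expo by (simp flip: exp_add)
    also have "\<dots> \<le> exp (- real N)"
      using ln mult_left_mono[of 1 "ln (real N)" "real N"] by simp
    finally have "real N ^ N * exp (- (real N)\<^sup>2 * p N * \<eta>\<^sup>2 / 64) \<le> exp (- real N)" .
    moreover have "exp (- (real N)\<^sup>2 * p N) \<le> exp (- real N)" using N2p by simp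
    ultimately show ?case using * by linarith
  qed
  show "(\<lambda>N. 1 - 2 * exp (- real N)) \<longlonglongrightarrow> 1" by real_asymp
qed auto

theorem theorem5p1:
  shows "(\<forall>p :: nat \<Rightarrow> real. (\<forall>N. 0 \<le> p N \<and> p N \<le> 1) \<longrightarrow>
            (limsup (\<lambda>N. ereal (p N)) < 1 \<longleftrightarrow>
             (\<exists>\<delta>0>0. \<forall>\<^sub>F N in sequentially. p N \<le> 1 - \<delta>0))) \<and>
         (\<forall>\<delta>0 :: real. \<delta>0 > 0 \<longrightarrow>
           (\<exists>c :: real. c > 0 \<and>
             (\<forall>p :: nat \<Rightarrow> real.
                (\<forall>N. 0 \<le> p N \<and> p N \<le> 1) \<longrightarrow>
                filterlim (\<lambda>N. real N * p N / ln (real N)) at_top sequentially \<longrightarrow>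
                (\<forall>\<^sub>F N in sequentially. p N \<le> 1 - \<delta>0) \<longrightarrow>
                (\<lambda>N. measure_pmf.prob (erdos_renyi N (p N))
                   {G. snd G \<noteq> {} \<and>
                       c * real N \<le> edge_complexity G \<and> edge_complexity G \<le> real N})
                  \<longlonglongrightarrow> 1)))"
proof (intro conjI allI impI)
  fix \<delta>0 :: real assume \<delta>0: "\<delta>0 > 0"
  show "\<exists>c :: real. c > 0 \<and>
             (\<forall>p :: nat \<Rightarrow> real.
                (\<forall>N. 0 \<le> p N \<and> p N \<le> 1) \<longrightarrow>
                filterlim (\<lambda>N. real N * p N / ln (real N)) at_top sequentially \<longrightarrow>
                (\<forall>\<^sub>F N in sequentially. p N \<le> 1 - \<delta>0) \<longrightarrow>
                (\<lambda>N. measure_pmf.prob (erdos_renyi N (p N))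
                   {G. snd G \<noteq> {} \<and>
                       c * real N \<le> edge_complexity G \<and> edge_complexity G \<le> real N})
                  \<longlonglongrightarrow> 1)"
  \<comment> \<open>The witness is fixed before the sequence \<open>p\<close> is introduced and
    therefore depends on \<delta>0 alone.\<close>
  proof (intro exI[of _ "(1 - exp (- \<delta>0 / 16)) / 4"] conjI allI impI)
    show "0 < (1 - exp (- \<delta>0 / 16)) / 4" using \<delta>0 by simp
  qed (use \<delta>0 in \<open>blast intro: edge_complexity_whp\<close>)
qed (rule limsup_less_one_iff)

end
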